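(* Let $N\ge1$, $0<p<\infty$, $0<q\le\infty$, $s\in(0,\infty)$ and $0<\lambda<p$. There exists a constant $C=C(N,s,p,q,\lambda)$ such that for every $u\in BMO(\mathbb{R}^N)\cap (B^{s}_{\lambda,q\frac{\lambda}{p}})_w(\mathbb{R}^N)$ (with $q\frac{\lambda}{p}:=\infty$ if $q=\infty$) the following holds. If $q<\infty$, $$\|u\|_{B^{s\frac{\lambda}{p}}_{p,q}(\mathbb{R}^N)}\le C\|u\|_{BMO(\mathbb{R}^N)}^{1-\frac{\lambda}{p}}\Big(\|u\|_{(B^{s}_{\lambda,q\frac{\lambda}{p}})_w(\mathbb{R}^N)}\Big)^{\frac{\lambda}{p}}\le C\|u\|_{BMO(\mathbb{R}^N)}^{1-\frac{\lambda}{p}}\Big(\|u\|_{B^{s}_{\lambda,q\frac{\lambda}{p}}(\mathbb{R}^N)}\Big)^{\frac{\lambda}{p}};$$ if $q=\infty$, $$\|u\|_{B^{s\frac{\lambda}{p}}_{p,\infty}(\mathbb{R}^N)}\le C\|u\|_{BMO(\mathbb{R}^N)}^{1-\frac{\lambda}{p}}\Big(\|u\|_{(B^{s}_{\lambda,\infty})_w(\mathbb{R}^N)}\Big)^{\frac{\lambda}{p}}\le C\|u\|_{BMO(\mathbb{R}^N)}^{1-\frac{\lambda}{p}}\Big(\|u\|_{B^{s}_{\lambda,\infty}(\mathbb{R}^N)}\Big)^{\frac{\lambda}{p}}.$$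
   Context: $\mathcal{L}^N$ is Lebesgue measure. Weak Lebesgue quasi-norm: $\|f\|_{L^p_w(\mathbb{R}^N)}:=\left[\sup_{t>0}t\,\mathcal{L}^N(\{|f|^p>t\})\right]^{1/p}$. For $k\in\mathbb{N}$, $h\in\mathbb{R}^N$: $\Delta_h^kf(x):=\sum_{j=0}^k\binom{k}{j}(-1)^{k-j}f(x+jh)$. Moduli of continuity, for $t>0$: $\Omega_k(f,t)_{L^p}:=\sup_{|h|\le t}\|\Delta_h^kf\|_{L^p(\mathbb{R}^N)}$ and $\Omega_k(f,t)_{L^p_w}:=\sup_{|h|\le t}\|\Delta_h^kf\|_{L^p_w(\mathbb{R}^N)}$. Besov spaces: for $s\in(0,\infty)$ let $k\in\mathbb{N}$ be minimal with $s<k$; for $0<p<\infty$, $$\|f\|_{B^s_{p,q}(\mathbb{R}^N)}:=\left(\int_0^\infty\Big(\frac{\Omega_k(f,t)_{L^p}}{t^s}\Big)^q\frac{dt}{t}\right)^{1/q}\ (q<\infty),\qquad \|f\|_{B^s_{p,\infty}(\mathbb{R}^N)}:=\sup_{0<t<\infty}\frac{\Omega_k(f,t)_{L^p}}{t^s},$$ possibly $+\infty$; $f\in B^s_{p,q}$ iff $f\in L^p$ and this is finite. The weak quasi-seminorm $\|f\|_{(B^s_{p,q})_w(\mathbb{R}^N)}$ is defined by the same formulas with $\Omega_k(f,t)_{L^p_w}$ in place of $\Omega_k(f,t)_{L^p}$, and $f\in(B^s_{p,q})_w$ iff $f\in L^p_w$ and it is finite. A cube is a Cartesian product of $N$ non-empty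 closed bounded intervals of the same (positive) length. For real-valued $u\in L^1_{\mathrm{loc}}(\mathbb{R}^N)$, $u\in BMO(\mathbb{R}^N)$ means that $$\|u\|_{BMO(\mathbb{R}^N)}:=\sup\left\{\frac{1}{\mathcal{L}^N(C)^2}\int_C\int_C|u(z)-u(x)|\,dz\,dx : C\subset \mathbb{R}^N\text{ a cube}\right\}<\infty .$$ Convention: $0\cdot\infty=0$. *)

theory Defs
  imports "HOL-Analysis.Analysis"
begin

(* Only used with a > 0, where \<infinity>^a = \<infinity> and 0^a = 0. *)
definition ennpowr :: "ennreal \<Rightarrow> real \<Rightarrow> ennreal" where
  "ennpowr x a = (if x = top then top else ennreal (enn2real x powr a))"

definition Lp_norm :: "real \<Rightarrow> (real ^ 'n \<Rightarrow> real) \<Rightarrow> ennreal" where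
  "Lp_norm p f = ennpowr (\<integral>\<^sup>+ x. ennreal (\<bar>f x\<bar> powr p) \<partial>lebesgue) (1 / p)"

definition weak_Lp_norm :: "real \<Rightarrow> (real ^ 'n \<Rightarrow> real) \<Rightarrow> ennreal" where
  "weak_Lp_norm p f =
    ennpowr (SUP t\<in>{0<..}. ennreal t * emeasure lebesgue {x. \<bar>f x\<bar> powr p > t}) (1 / p)"

definition weak_Lp_space :: "real \<Rightarrow> (real ^ 'n \<Rightarrow> real) set" where
  "weak_Lp_space p = {f. f \<in> borel_measurable lebesgue \<and> weak_Lp_norm p f < top}"

definition fwd_diff :: "nat \<Rightarrow> real ^ 'n \<Rightarrow> (real ^ 'n \<Rightarrow> real) \<Rightarrow> real ^ 'n \<Rightarrow> real" where
  "fwd_diff k h f x = (\<Sum>j=0..k. real (k choose j) * (-1) ^ (k - j) * f (x + real j *\<^sub>R h))"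

(* The argument M is the functional measuring the differences: the strong L^p
   or the weak L^p quasi-norm. *)
definition modulus ::
  "((real ^ 'n \<Rightarrow> real) \<Rightarrow> ennreal) \<Rightarrow> nat \<Rightarrow> (real ^ 'n \<Rightarrow> real) \<Rightarrow> real \<Rightarrow> ennreal" where
  "modulus M k f t = (SUP h\<in>{h. norm h \<le> t}. M (fwd_diff k h f))"

definition diff_order :: "real \<Rightarrow> nat" where
  "diff_order s = (LEAST k. s < real k)"

definition besov_functional ::
  "((real ^ 'n \<Rightarrow> real) \<Rightarrow> ennreal) \<Rightarrow> real \<Rightarrow> ennreal \<Rightarrow> (real ^ 'n \<Rightarrow> real) \<Rightarrow> ennreal" where
  "besov_functional M s q f =
    (if q = top
     then (SUP t\<in>{0<..}. modulus M (diff_order s) f t / ennreal (t powr s))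
     else ennpowr
       (\<integral>\<^sup>+ t\<in>{0<..}. ennpowr (modulus M (diff_order s) f t / ennreal (t powr s)) (enn2real q)
                       / ennreal t \<partial>lborel)
       (1 / enn2real q))"

definition besov_norm :: "real \<Rightarrow> real \<Rightarrow> ennreal \<Rightarrow> (real ^ 'n \<Rightarrow> real) \<Rightarrow> ennreal" where
  "besov_norm s p q = besov_functional (Lp_norm p) s q"

definition weak_besov_norm :: "real \<Rightarrow> real \<Rightarrow> ennreal \<Rightarrow> (real ^ 'n \<Rightarrow> real) \<Rightarrow> ennreal" where
  "weak_besov_norm s p q = besov_functional (weak_Lp_norm p) s q"

definition weak_besov_space :: "real \<Rightarrow> real \<Rightarrow> ennreal \<Rightarrow> (real ^ 'n \<Rightarrow> real) set" where
  "weak_besov_space s p q = {f \<in> weak_Lp_space p. weak_besov_norm s p q f < top}"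

definition L1_loc :: "(real ^ 'n \<Rightarrow> real) set" where
  "L1_loc = {u. \<forall>K. compact K \<longrightarrow> u absolutely_integrable_on K}"

definition cubes :: "(real ^ 'n) set set" where
  "cubes = {cbox a (\<chi> i. a $ i + l) | a l. 0 < l}"

definition BMO_norm :: "(real ^ 'n \<Rightarrow> real) \<Rightarrow> ennreal" where
  "BMO_norm u = (SUP C\<in>cubes.
     (\<integral>\<^sup>+ x\<in>C. (\<integral>\<^sup>+ z\<in>C. ennreal \<bar>u z - u x\<bar> \<partial>lebesgue) \<partial>lebesgue) / (emeasure lebesgue C)\<^sup>2)"

definition BMO :: "(real ^ 'n \<Rightarrow> real) set" where
  "BMO = {u \<in> L1_loc. BMO_norm u < top}"

end

theory Submission
  imports Defs
begin

text \<open>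
  For \<open>f\<close> in BMO and \<open>t > 0\<close> take the maximal dyadic cubes that are more than half filled by
  \<open>{|f| > t}\<close>. Comparing each of them with its parent, which is at most half filled, yields
  \<open>t |{|f| > 2t}| \<le> 2 ^ (N + 2) \<parallel>f\<parallel>\<^sub>B\<^sub>M\<^sub>O |{|f| > t}|\<close>. Hence the distribution function decays fast above the
  level \<open>\<tau> \<sim> \<parallel>f\<parallel>\<^sub>B\<^sub>M\<^sub>O\<close>, while below \<open>\<tau>\<close> it is controlled by the weak \<open>L\<^sup>r\<close> norm; summing over dyadic
  levels bounds the \<open>p\<close>-th power integral of \<open>|f|\<close> by \<open>\<parallel>f\<parallel>\<^sub>B\<^sub>M\<^sub>O\<close> to the power \<open>p - r\<close> times the \<open>r\<close>-th power
  of the weak norm. Applied to the differences of \<open>u\<close> of the order \<open>K\<close> belonging to \<open>s\<close>, this interpolates the moduli.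

  The Besov norm of smoothness \<open>s r / p\<close> may use differences of a lower order \<open>k\<close>. The identity
  \<open>(T\<^sup>2 - 1) ^ k = (T + 1) ^ k (T - 1) ^ k\<close> for translations \<open>T\<close> bounds the modulus of order \<open>k\<close> at \<open>t\<close> by
  \<open>2 powr - k\<close> times the one at \<open>2 t\<close>, plus the modulus of order \<open>k + 1\<close>. As the smoothness is less than \<open>k\<close>,
  the first term can be absorbed after truncation to large \<open>t\<close>.
\<close>

section \<open>Powers of extended nonnegative reals\<close>

lemma ennpowr_top [simp]: "ennpowr top a = top"
  by (simp add: ennpowr_def)

lemma ennpowr_ennreal: "0 \<le> x \<Longrightarrow> ennpowr (ennreal x) a = ennreal (x powr a)"
  by (simp add: ennpowr_def)

lemma ennpowr_0 [simp]: "ennpowr 0 a = 0"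
  by (simp add: ennpowr_def)

lemma ennpowr_one [simp]: "ennpowr x 1 = x"
  by (simp add: ennpowr_def less_top)

lemma ennpowr_eq_top_iff [simp]: "ennpowr x a = top \<longleftrightarrow> x = top"
  by (simp add: ennpowr_def)

lemma ennpowr_less_top_iff [simp]: "ennpowr x a < top \<longleftrightarrow> x < top"
  by (simp add: less_top[symmetric])

lemma ennpowr_mono: "x \<le> y \<Longrightarrow> 0 \<le> a \<Longrightarrow> ennpowr x a \<le> ennpowr y a"
  by (cases x; cases y) (auto simp: ennpowr_ennreal ennreal_leI powr_mono2 top_unique)

lemma ennpowr_ennpowr: "ennpowr (ennpowr x a) b = ennpowr x (a * b)"
  by (cases x) (auto simp: ennpowr_ennreal powr_powr)

lemma ennpowr_mult: "ennpowr (x * y) a = ennpowr x a * ennpowr y a"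
proof (cases "x = 0 \<or> y = 0 \<or> x = top \<or> y = top")
  case True
  have *: "ennpowr z a = 0 \<longleftrightarrow> z = 0" for z
    by (cases z) (auto simp: ennpowr_ennreal)
  from True show ?thesis
    by (auto simp: ennreal_mult_top ennreal_top_mult *)
next
  case False
  then show ?thesis
    by (cases x; cases y)
      (auto simp: ennpowr_ennreal ennreal_mult[symmetric] powr_mult)
qed

lemma ennpowr_divide:
  assumes "0 < c"
  shows "ennpowr (x / ennreal c) a = ennpowr x a / ennreal (c powr a)"
proof (cases x)
  case (real y)
  then show ?thesis
    using assms by (simp add: ennpowr_ennreal divide_ennreal powr_divide)
qed (simp add: ennreal_top_divide)

text \<open>On \<open>[0, \<infinity>]\<close> a positive power is an order isomorphism with inverse
  the power \<open>1 / a\<close>; this adjunction moves powers across suprema in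
  \<open>ennpowr_SUP\<close>.\<close>

lemma ennpowr_le_iff:
  assumes "0 < a"
  shows "ennpowr x a \<le> y \<longleftrightarrow> x \<le> ennpowr y (1 / a)"
proof
  assume "ennpowr x a \<le> y"
  from ennpowr_mono[OF this, of "1 / a"] show "x \<le> ennpowr y (1 / a)"
    using assms by (simp add: ennpowr_ennpowr)
next
  assume "x \<le> ennpowr y (1 / a)"
  from ennpowr_mono[OF this, of a] show "ennpowr x a \<le> y"
    using assms by (simp add: ennpowr_ennpowr)
qed

lemma ennpowr_SUP:
  assumes "0 < a"
  shows "ennpowr (SUP i\<in>I. f i) a = (SUP i\<in>I. ennpowr (f i) a)"
proof (rule antisym)
  show "ennpowr (SUP i\<in>I. f i) a \<le> (SUP i\<in>I. ennpowr (f i) a)"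
    unfolding ennpowr_le_iff[OF assms]
    by (rule SUP_least) (auto simp: ennpowr_le_iff[OF assms, symmetric] intro: SUP_upper)
  show "(SUP i\<in>I. ennpowr (f i) a) \<le> ennpowr (SUP i\<in>I. f i) a"
    using assms by (auto intro!: SUP_least ennpowr_mono SUP_upper)
qed

text \<open>Superlevel sets of a monotone function are closed upwards, so each is empty, everything,
  or an open or closed ray from its infimum. This makes moduli measurable in the bound on the
  step.\<close>

lemma borel_measurable_mono_ennreal:
  fixes f :: "real \<Rightarrow> ennreal"
  assumes "mono f"
  shows "f \<in> borel_measurable borel"
proof (rule borel_measurableI_greater)
  fix y
  let ?S = "{x. y < f x}"
  have up: "b \<in> ?S" if "a \<in> ?S" "a \<le> b" for a b
    using that monoD[OF assms, of a b] by auto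
  have "?S \<in> sets borel"
  proof (cases "?S = {} \<or> \<not> bdd_below ?S")
    case True
    then have "?S = {} \<or> ?S = UNIV"
      using up unfolding bdd_below_def by (metis (no_types, lifting) UNIV_eq_I le_cases)
    then show ?thesis by (metis sets.empty_sets sets.top space_borel)
  next
    case False
    have "{Inf ?S<..} \<subseteq> ?S"
    proof
      fix b assume "b \<in> {Inf ?S<..}"
      then obtain a where "a \<in> ?S" "a < b"
        using False cInf_lessD[of ?S b] by auto
      then show "b \<in> ?S"
        using up by auto
    qed
    moreover have "?S \<subseteq> {Inf ?S..}"
      using False by (auto intro: cInf_lower)
    ultimately have "?S = {Inf ?S<..} \<or> ?S = {Inf ?S..}"
      by (force simp: le_less)
    then show ?thesis by (metis borel_closed borel_open closed_atLeast open_greaterThan)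
  qed
  then show "{x \<in> space borel. y < f x} \<in> sets borel"
    by simp
qed

text \<open>Let \<open>\<eta>\<close> solve
  \<open>(1 + \<eta>) powr \<alpha> = 1 + \<delta>\<close>. Either
  \<open>b \<le> \<eta> * a\<close>, and the sum is at most \<open>(1 + \<eta>) * a\<close>, or
  \<open>a\<close> is less than \<open>b / \<eta>\<close>, and the sum is bounded by a multiple of
  \<open>b\<close>. A leading factor as close to 1 as desired is what the later absorption depends
  on.\<close>

lemma powr_add_le_eps:
  fixes \<alpha> \<delta> :: real
  assumes "0 < \<alpha>" "0 < \<delta>"
  obtains C where "0 < C"
    "\<And>a b. 0 \<le> a \<Longrightarrow> 0 \<le> b \<Longrightarrow> (a + b) powr \<alpha> \<le> (1 + \<delta>) * a powr \<alpha> + C * b powr \<alpha>"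
proof
  define \<eta> where "\<eta> = (1 + \<delta>) powr (1 / \<alpha>) - 1"
  have \<eta>: "0 < \<eta>" and eq: "(1 + \<eta>) powr \<alpha> = 1 + \<delta>"
    using assms by (auto simp: \<eta>_def powr_powr intro!: gr_one_powr)
  show "0 < (1 + 1 / \<eta>) powr \<alpha>"
    using \<eta> by (simp add: field_simps)
  fix a b :: real assume ab: "0 \<le> a" "0 \<le> b"
  show "(a + b) powr \<alpha> \<le> (1 + \<delta>) * a powr \<alpha> + (1 + 1 / \<eta>) powr \<alpha> * b powr \<alpha>"
  proof (cases "b \<le> \<eta> * a")
    case True
    have "(a + b) powr \<alpha> \<le> ((1 + \<eta>) * a) powr \<alpha>"
      using True ab assms by (intro powr_mono2) (auto simp: algebra_simps)
    also have "\<dots> = (1 + \<delta>) * a powr \<alpha>"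
      using ab \<eta> by (simp add: powr_mult eq)
    finally show ?thesis
      using mult_nonneg_nonneg[OF powr_ge_zero[of "1 + 1 / \<eta>" \<alpha>] powr_ge_zero[of b \<alpha>]] by linarith
  next
    case False
    then have "a \<le> 1 / \<eta> * b"
      using \<eta> by (simp add: field_simps)
    then have "(a + b) powr \<alpha> \<le> ((1 + 1 / \<eta>) * b) powr \<alpha>"
      using ab assms by (intro powr_mono2) (auto simp: algebra_simps)
    also have "\<dots> = (1 + 1 / \<eta>) powr \<alpha> * b powr \<alpha>"
      using ab \<eta> by (simp add: powr_mult)
    finally show ?thesis
      using mult_nonneg_nonneg[OF _ powr_ge_zero[of a \<alpha>], of "1 + \<delta>"] assms by linarith
  qed
qed

lemma ennpowr_add_le_eps:
  fixes \<alpha> \<delta> :: real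
  assumes "0 < \<alpha>" "0 < \<delta>"
  obtains C where "0 < C"
    "\<And>x y. ennpowr (x + y) \<alpha> \<le> ennreal (1 + \<delta>) * ennpowr x \<alpha> + ennreal C * ennpowr y \<alpha>"
proof -
  obtain C where C: "0 < C"
    "\<And>a b. 0 \<le> a \<Longrightarrow> 0 \<le> b \<Longrightarrow> (a + b) powr \<alpha> \<le> (1 + \<delta>) * a powr \<alpha> + C * b powr \<alpha>"
    using powr_add_le_eps[OF assms] by blast
  have "ennpowr (x + y) \<alpha> \<le> ennreal (1 + \<delta>) * ennpowr x \<alpha> + ennreal C * ennpowr y \<alpha>" for x y
  proof (cases "x = top \<or> y = top")
    case True
    then show ?thesis
      using assms C(1) by (auto simp: ennreal_mult_top)
  next
    case False
    then show ?thesis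
      using C assms
      by (cases x; cases y)
        (auto simp: ennpowr_ennreal ennreal_mult[symmetric] ennreal_plus[symmetric]
          intro!: ennreal_leI simp del: ennreal_plus)
  qed
  with C(1) that show ?thesis by blast
qed

section \<open>Finite differences\<close>

lemma fwd_diff_0 [simp]: "fwd_diff 0 h f = f"
  by (auto simp: fwd_diff_def fun_eq_iff)

text \<open>Pascal's rule under a sum. The recursion for differences and the formula for the doubled
  step both reduce to it.\<close>

lemma sum_choose_Suc:
  fixes g :: "nat \<Rightarrow> real"
  shows "(\<Sum>j\<le>Suc k. real (Suc k choose j) * g j)
    = (\<Sum>j\<le>k. real (k choose j) * g (Suc j)) + (\<Sum>j\<le>k. real (k choose j) * g j)"
proof -
  have "(\<Sum>j\<le>Suc k. real (Suc k choose j) * g j)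
      = (\<Sum>j\<le>k. real (k choose j) * g (Suc j)) + (g 0 + (\<Sum>j\<le>k. real (k choose Suc j) * g (Suc j)))"
    by (subst sum.atMost_Suc_shift) (simp add: algebra_simps sum.distrib)
  also have "g 0 + (\<Sum>j\<le>k. real (k choose Suc j) * g (Suc j)) = (\<Sum>j\<le>Suc k. real (k choose j) * g j)"
    by (subst sum.atMost_Suc_shift) simp
  finally show ?thesis by simp
qed

lemma fwd_diff_Suc: "fwd_diff (Suc k) h f x = fwd_diff k h f (x + h) - fwd_diff k h f x"
proof -
  \<comment> \<open>Parity replaces the truncated subtraction \<open>k - j\<close> in the exponent,
    so that \<open>(-1) ^ k\<close> leaves the sum.\<close>
  have sgn: "(-1) ^ (k - j) = (-1) ^ k * ((-1) ^ j :: real)" if "j \<le> k" for j k :: nat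
    using that by (auto simp: uminus_power_if)
  have diff: "fwd_diff k h f x = (-1) ^ k * (\<Sum>j\<le>k. real (k choose j) * ((-1) ^ j * f (x + real j *\<^sub>R h)))"
    for k x
    unfolding fwd_diff_def sum_distrib_left atLeast0AtMost
    by (rule sum.cong) (auto simp: sgn)
  show ?thesis
    unfolding diff sum_choose_Suc
    by (simp add: algebra_simps sum_negf)
qed

text \<open>For \<open>T\<close> the translation by \<open>h\<close>, this is
  \<open>(T^2 - 1)^k = (T + 1)^k (T - 1)^k\<close> with the first factor expanded by the binomial
  theorem.\<close>

lemma fwd_diff_double:
  "fwd_diff k (2 *\<^sub>R h) f x = (\<Sum>j\<le>k. real (k choose j) * fwd_diff k h f (x + real j *\<^sub>R h))"
proof (induction k arbitrary: x)
  case (Suc k)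
  let ?S = "\<lambda>x. \<Sum>j\<le>k. real (k choose j) * fwd_diff k h f (x + real j *\<^sub>R h)"
  have "(\<Sum>j\<le>Suc k. real (Suc k choose j) * fwd_diff (Suc k) h f (x + real j *\<^sub>R h))
    = ?S (x + 2 *\<^sub>R h) - ?S x"
    unfolding sum_choose_Suc fwd_diff_Suc
    by (simp add: right_diff_distrib sum_subtractf scaleR_2 scaleR_left_distrib add.assoc)
      (simp add: add_ac)
  then show ?case
    by (simp add: fwd_diff_Suc Suc)
qed simp

text \<open>Telescoping: \<open>T^j - 1\<close> is the sum of \<open>T^i (T - 1)\<close> over
  \<open>i < j\<close>, applied to the difference of order \<open>k\<close>.\<close>

lemma translate_diff_eq_sum_fwd_diff:
  "fwd_diff k h f (x + real j *\<^sub>R h) - fwd_diff k h f x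
    = (\<Sum>i<j. fwd_diff (Suc k) h f (x + real i *\<^sub>R h))"
  by (induction j) (auto simp: fwd_diff_Suc scaleR_left_distrib algebra_simps)

text \<open>The weights in \<open>fwd_diff_double\<close> add up to \<open>2 ^ k\<close>. Replacing
  every translate by the value at \<open>x\<close> therefore yields \<open>2 ^ k\<close> times the
  difference with step \<open>h\<close>, and the errors are telescoping sums of differences of order
  \<open>Suc k\<close>.\<close>

lemma abs_fwd_diff_le_double:
  "\<bar>fwd_diff k h f x\<bar> \<le> \<bar>fwd_diff k (2 *\<^sub>R h) f x\<bar> / 2 ^ k
    + (\<Sum>i<k. \<bar>fwd_diff (Suc k) h f (x + real i *\<^sub>R h)\<bar>)"
proof -
  let ?E = "\<lambda>i. fwd_diff (Suc k) h f (x + real i *\<^sub>R h)"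
  have *: "(\<Sum>j\<le>k. real (k choose j)) = 2 ^ k"
    using choose_row_sum[of k] by (simp flip: of_nat_sum)
  have "fwd_diff k (2 *\<^sub>R h) f x - 2 ^ k * fwd_diff k h f x = (\<Sum>j\<le>k. real (k choose j) * (\<Sum>i<j. ?E i))"
    unfolding translate_diff_eq_sum_fwd_diff[symmetric]
    by (simp add: fwd_diff_double right_diff_distrib sum_subtractf sum_distrib_right[symmetric] *)
  moreover have "\<bar>\<Sum>j\<le>k. real (k choose j) * (\<Sum>i<j. ?E i)\<bar> \<le> (\<Sum>j\<le>k. real (k choose j) * (\<Sum>i<k. \<bar>?E i\<bar>))"
  proof (intro order.trans[OF sum_abs] sum_mono)
    fix j assume "j \<in> {..k}"
    then have "\<bar>\<Sum>i<j. ?E i\<bar> \<le> (\<Sum>i<k. \<bar>?E i\<bar>)"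
      by (intro order.trans[OF sum_abs] sum_mono2) auto
    then show "\<bar>real (k choose j) * (\<Sum>i<j. ?E i)\<bar> \<le> real (k choose j) * (\<Sum>i<k. \<bar>?E i\<bar>)"
      by (simp add: abs_mult mult_left_mono)
  qed
  ultimately have "2 ^ k * \<bar>fwd_diff k h f x\<bar> \<le> \<bar>fwd_diff k (2 *\<^sub>R h) f x\<bar> + 2 ^ k * (\<Sum>i<k. \<bar>?E i\<bar>)"
    unfolding sum_distrib_right[symmetric] * by (simp add: abs_mult[symmetric])
  then show ?thesis
    by (simp add: field_simps)
qed

section \<open>Lebesgue measure: sigma-finiteness and translation invariance\<close>

lemma sigma_finite_lebesgue: "sigma_finite_measure (lebesgue :: 'a::euclidean_space measure)"
proof
  obtain A :: "'a set set" where A: "countable A" "A \<subseteq> sets lborel" "\<Union>A = space lborel"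
    "\<forall>a\<in>A. emeasure lborel a \<noteq> \<infinity>"
    using lborel.sigma_finite_countable by blast
  then show "\<exists>A::'a set set. countable A \<and> A \<subseteq> sets lebesgue \<and> \<Union>A = space lebesgue
      \<and> (\<forall>a\<in>A. emeasure lebesgue a \<noteq> \<infinity>)"
    by (intro exI[of _ A]) (auto simp: subset_iff emeasure_completion)
qed

lemma distr_lebesgue_translation:
  "distr lebesgue lebesgue (\<lambda>x. x + c) = (lebesgue :: 'a::euclidean_space measure)"
proof -
  \<comment> \<open>The translation is the affine coordinate map with all scale factors 1, hence
    with Jacobian 1.\<close>
  have "(\<lambda>x::'a. c + (\<Sum>j\<in>Basis. (1 * (x \<bullet> j)) *\<^sub>R j)) = (\<lambda>x. x + c)"
    by (simp add: euclidean_representation add.commute)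
  with lebesgue_affine_euclidean[of "\<lambda>_. 1" c] show ?thesis
    by (simp add: density_1)
qed

lemma measurable_lebesgue_translation [measurable]:
  "(\<lambda>x. x + c) \<in> lebesgue \<rightarrow>\<^sub>M (lebesgue :: 'a::euclidean_space measure)"
proof -
  have "(\<lambda>x::'a. c + (\<Sum>j\<in>Basis. (1 * (x \<bullet> j)) *\<^sub>R j)) = (\<lambda>x. x + c)"
    by (simp add: euclidean_representation add.commute)
  with lebesgue_affine_measurable[of "\<lambda>_. 1" c] show ?thesis
    by simp
qed

lemma nn_integral_lebesgue_translation:
  fixes f :: "'a::euclidean_space \<Rightarrow> ennreal"
  assumes "f \<in> borel_measurable lebesgue"
  shows "(\<integral>\<^sup>+x. f (x + c) \<partial>lebesgue) = (\<integral>\<^sup>+x. f x \<partial>lebesgue)"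
  by (subst (2) distr_lebesgue_translation[of c, symmetric]) (simp add: nn_integral_distr assms)

section \<open>Power integrals and moduli of differences\<close>

lemma fwd_diff_measurable [measurable]:
  assumes [measurable]: "f \<in> borel_measurable lebesgue"
  shows "fwd_diff k h f \<in> borel_measurable lebesgue"
proof -
  have "(\<lambda>x. f (x + real j *\<^sub>R h)) \<in> borel_measurable lebesgue" for j
    by measurable
  then show ?thesis
    unfolding fwd_diff_def[abs_def] by measurable
qed

text \<open>The integral before the root is taken. Estimates for it add up for every positive
  \<open>p\<close>, including \<open>p < 1\<close>, where the triangle inequality for
  \<open>Lp_norm\<close> fails.\<close>

definition power_integral :: "real \<Rightarrow> (real ^ 'n \<Rightarrow> real) \<Rightarrow> ennreal" where
  "power_integral p f = (\<integral>\<^sup>+x. ennreal (\<bar>f x\<bar> powr p) \<partial>lebesgue)"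

lemma Lp_norm_eq: "Lp_norm p f = ennpowr (power_integral p f) (1 / p)"
  by (simp add: Lp_norm_def power_integral_def)

lemma power_integral_translation:
  assumes [measurable]: "f \<in> borel_measurable lebesgue"
  shows "power_integral p (\<lambda>x. f (x + c)) = power_integral p f"
  unfolding power_integral_def
  by (rule nn_integral_lebesgue_translation[of "\<lambda>x. ennreal (\<bar>f x\<bar> powr p)"]) measurable

text \<open>The sum is at most \<open>card I\<close> times its largest term; this crude argument
  treats \<open>p < 1\<close> and \<open>p \<ge> 1\<close> alike.\<close>

lemma sum_powr_le:
  fixes a :: "'i \<Rightarrow> real"
  assumes "finite I" "0 < p" "\<And>i. i \<in> I \<Longrightarrow> 0 \<le> a i"
  shows "(\<Sum>i\<in>I. a i) powr p \<le> real (card I) powr p * (\<Sum>i\<in>I. a i powr p)"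
proof (cases "I = {}")
  case False
  define m where "m = Max (a ` I)"
  have m: "m \<in> a ` I" "\<And>i. i \<in> I \<Longrightarrow> a i \<le> m"
    using False assms by (auto simp: m_def)
  then obtain j where j: "j \<in> I" "m = a j" by auto
  have "(\<Sum>i\<in>I. a i) \<le> real (card I) * m"
    using sum_bounded_above[of I a m] m by auto
  then have "(\<Sum>i\<in>I. a i) powr p \<le> (real (card I) * m) powr p"
    using assms by (intro powr_mono2) (auto intro!: sum_nonneg)
  also have "\<dots> = real (card I) powr p * a j powr p"
    using j assms by (simp add: powr_mult)
  also have "\<dots> \<le> real (card I) powr p * (\<Sum>i\<in>I. a i powr p)"
    using j assms by (intro mult_left_mono member_le_sum) auto
  finally show ?thesis .
qed simp

text \<open>For each order the power of a two-term sum costs \<open>2 powr p\<close>, and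
  translation invariance gives the factor 2. The use is qualitative: if \<open>Lp_norm\<close> of a
  function is finite or zero, so are those of its differences.\<close>

lemma power_integral_fwd_diff_le:
  assumes [measurable]: "f \<in> borel_measurable lebesgue" and "0 < p"
  shows "power_integral p (fwd_diff k h f) \<le> ennreal ((2 * 2 powr p) ^ k) * power_integral p f"
proof (induction k)
  case 0
  show ?case by simp
next
  case (Suc k)
  let ?g = "fwd_diff k h f"
  have [measurable]: "(\<lambda>x. ?g (x + h)) \<in> borel_measurable lebesgue"
    by measurable
  have pw: "\<bar>fwd_diff (Suc k) h f x\<bar> powr p \<le> 2 powr p * (\<bar>?g (x + h)\<bar> powr p + \<bar>?g x\<bar> powr p)" for x
  proof -
    have "\<bar>fwd_diff (Suc k) h f x\<bar> powr p \<le> (\<bar>?g (x + h)\<bar> + \<bar>?g x\<bar>) powr p"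
      using assms by (intro powr_mono2) (auto simp: fwd_diff_Suc)
    also have "\<dots> \<le> 2 powr p * (\<bar>?g (x + h)\<bar> powr p + \<bar>?g x\<bar> powr p)"
      using sum_powr_le[of "UNIV :: bool set" p "\<lambda>b. if b then \<bar>?g (x + h)\<bar> else \<bar>?g x\<bar>"] assms
      by (simp add: UNIV_bool add.commute)
    finally show ?thesis .
  qed
  have "power_integral p (fwd_diff (Suc k) h f)
      \<le> (\<integral>\<^sup>+x. ennreal (2 powr p) * (ennreal (\<bar>?g (x + h)\<bar> powr p) + ennreal (\<bar>?g x\<bar> powr p)) \<partial>lebesgue)"
    unfolding power_integral_def using pw
    by (intro nn_integral_mono)
      (simp add: ennreal_mult[symmetric] ennreal_plus[symmetric] ennreal_leI del: ennreal_plus)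
  also have "\<dots> = ennreal (2 powr p) * (power_integral p (\<lambda>x. ?g (x + h)) + power_integral p ?g)"
    unfolding power_integral_def by (simp add: nn_integral_cmult nn_integral_add)
  also have "\<dots> = ennreal (2 * 2 powr p) * power_integral p ?g"
    by (simp add: power_integral_translation ennreal_mult mult_2[symmetric] mult_ac)
  also have "\<dots> \<le> ennreal (2 * 2 powr p) * (ennreal ((2 * 2 powr p) ^ k) * power_integral p f)"
    by (intro mult_left_mono Suc) auto
  also have "\<dots> = ennreal ((2 * 2 powr p) ^ Suc k) * power_integral p f"
    by (simp add: ennreal_mult mult_ac)
  finally show ?case .
qed

text \<open>The pointwise comparison with the doubled step, raised to the power \<open>p\<close>.
  Only the first constant matters later: it keeps the gain \<open>2 powr - (k * p)\<close> up to the
  factor \<open>1 + \<delta>\<close>.\<close>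

lemma power_integral_fwd_diff_le_double:
  assumes "0 < p" "0 < \<delta>"
  obtains C where "0 < C"
    "\<And>f :: real ^ 'n \<Rightarrow> real. \<And>h. f \<in> borel_measurable lebesgue \<Longrightarrow>
      power_integral p (fwd_diff k h f)
        \<le> ennreal ((1 + \<delta>) / 2 powr (k * p)) * power_integral p (fwd_diff k (2 *\<^sub>R h) f)
          + ennreal C * power_integral p (fwd_diff (Suc k) h f)"
proof -
  obtain C where C: "0 < C"
    "\<And>a b. 0 \<le> a \<Longrightarrow> 0 \<le> b \<Longrightarrow> (a + b) powr p \<le> (1 + \<delta>) * a powr p + C * b powr p"
    using powr_add_le_eps[OF assms] by blast
  define D where "D = C * real k powr p"
  have D: "0 \<le> D" using C by (simp add: D_def)
  have main: "power_integral p (fwd_diff k h f)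
        \<le> ennreal ((1 + \<delta>) / 2 powr (k * p)) * power_integral p (fwd_diff k (2 *\<^sub>R h) f)
          + ennreal (D * k + 1) * power_integral p (fwd_diff (Suc k) h f)"
    if [measurable]: "f \<in> borel_measurable lebesgue" for f :: "real ^ 'n \<Rightarrow> real" and h
  proof -
    let ?a = "\<lambda>x. fwd_diff k (2 *\<^sub>R h) f x" and ?E = "fwd_diff (Suc k) h f"
    have [measurable]: "(\<lambda>x. ?E (x + real i *\<^sub>R h)) \<in> borel_measurable lebesgue" for i
      by measurable
    have pw: "\<bar>fwd_diff k h f x\<bar> powr p
        \<le> (1 + \<delta>) / 2 powr (k * p) * \<bar>?a x\<bar> powr p + D * (\<Sum>i<k. \<bar>?E (x + real i *\<^sub>R h)\<bar> powr p)" for x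
    proof -
      have "\<bar>fwd_diff k h f x\<bar> powr p \<le> (\<bar>?a x\<bar> / 2 ^ k + (\<Sum>i<k. \<bar>?E (x + real i *\<^sub>R h)\<bar>)) powr p"
        using assms by (intro powr_mono2 abs_fwd_diff_le_double) auto
      also have "\<dots> \<le> (1 + \<delta>) * (\<bar>?a x\<bar> / 2 ^ k) powr p + C * (\<Sum>i<k. \<bar>?E (x + real i *\<^sub>R h)\<bar>) powr p"
        by (intro C sum_nonneg) auto
      also have "(\<bar>?a x\<bar> / 2 ^ k) powr p = \<bar>?a x\<bar> powr p / 2 powr (k * p)"
        by (simp add: powr_divide powr_powr powr_realpow[symmetric])
      also have "C * (\<Sum>i<k. \<bar>?E (x + real i *\<^sub>R h)\<bar>) powr p
          \<le> C * (real k powr p * (\<Sum>i<k. \<bar>?E (x + real i *\<^sub>R h)\<bar> powr p))"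
        using sum_powr_le[of "{..<k}" p] C assms by (intro mult_left_mono) auto
      finally show ?thesis
        by (simp add: D_def mult_ac)
    qed
    have "power_integral p (fwd_diff k h f)
        \<le> (\<integral>\<^sup>+x. ennreal ((1 + \<delta>) / 2 powr (k * p)) * ennreal (\<bar>?a x\<bar> powr p)
            + ennreal D * (\<Sum>i<k. ennreal (\<bar>?E (x + real i *\<^sub>R h)\<bar> powr p)) \<partial>lebesgue)"
      unfolding power_integral_def using pw D assms
      by (intro nn_integral_mono)
        (simp add: ennreal_mult[symmetric] ennreal_plus[symmetric] sum_nonneg ennreal_leI del: ennreal_plus)
    also have "\<dots> = ennreal ((1 + \<delta>) / 2 powr (k * p)) * power_integral p ?a
        + ennreal D * (\<Sum>i<k. power_integral p (\<lambda>x. ?E (x + real i *\<^sub>R h)))"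
      unfolding power_integral_def by (simp add: nn_integral_cmult nn_integral_add nn_integral_sum del: sum_ennreal)
    also have "(\<Sum>i<k. power_integral p (\<lambda>x. ?E (x + real i *\<^sub>R h))) = ennreal k * power_integral p ?E"
      by (simp add: power_integral_translation ennreal_of_nat_eq_real_of_nat)
    also have "ennreal D * (ennreal k * power_integral p ?E) = ennreal (D * k) * power_integral p ?E"
      using D by (simp add: ennreal_mult mult_ac)
    also have "\<dots> \<le> ennreal (D * k + 1) * power_integral p ?E"
      by (intro mult_right_mono ennreal_leI) auto
    finally show ?thesis
      by (simp add: add_left_mono)
  qed
  \<comment> \<open>\<open>D\<close> vanishes for \<open>k = 0\<close>; the added 1 keeps the
    constant positive.\<close>
  have "0 < D * k + 1"
    using D by (smt (verit) mult_nonneg_nonneg of_nat_0_le_iff)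
  from that[OF this main] show ?thesis .
qed

lemma modulus_mono: "t \<le> t' \<Longrightarrow> modulus M k f t \<le> modulus M k f t'"
  unfolding modulus_def by (intro SUP_subset_mono) auto

lemma modulus_borel_measurable [measurable]: "modulus M k f \<in> borel_measurable borel"
  by (intro borel_measurable_mono_ennreal monoI modulus_mono)

lemma ennpowr_borel_measurable [measurable]:
  assumes [measurable]: "f \<in> borel_measurable M"
  shows "(\<lambda>x. ennpowr (f x) a) \<in> borel_measurable M"
  unfolding ennpowr_def by measurable

text \<open>The bound is uniform in \<open>t\<close>, so division by \<open>t powr s\<close>
  produces decay at infinity.\<close>

lemma modulus_Lp_le:
  assumes "f \<in> borel_measurable lebesgue" and "0 < p"
  shows "modulus (Lp_norm p) k f t \<le> ennreal (((2 * 2 powr p) ^ k) powr (1 / p)) * Lp_norm p f"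
  unfolding modulus_def Lp_norm_eq
proof (rule SUP_least)
  fix h
  have "ennpowr (power_integral p (fwd_diff k h f)) (1 / p)
      \<le> ennpowr (ennreal ((2 * 2 powr p) ^ k) * power_integral p f) (1 / p)"
    using assms by (intro ennpowr_mono power_integral_fwd_diff_le) auto
  then show "ennpowr (power_integral p (fwd_diff k h f)) (1 / p)
      \<le> ennreal (((2 * 2 powr p) ^ k) powr (1 / p)) * ennpowr (power_integral p f) (1 / p)"
    by (simp add: ennpowr_mult ennpowr_ennreal)
qed

text \<open>One doubling step of a Marchaud-type inequality. Doubling gains
  \<open>2 powr - (k * q)\<close> from the differences and loses \<open>2 powr (s * q)\<close> from
  the weight, a net factor below 1 since \<open>s < k\<close>.\<close>

lemma marchaud_pointwise:
  fixes p q s :: real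
  assumes "0 < p" "0 < q" "s < real k"
  obtains \<rho> C where "0 \<le> \<rho>" "\<rho> < 1" "0 < C"
    "\<And>f :: real ^ 'n \<Rightarrow> real. \<And>t. f \<in> borel_measurable lebesgue \<Longrightarrow> 0 < t \<Longrightarrow>
      ennpowr (modulus (Lp_norm p) k f t / ennreal (t powr s)) q
        \<le> ennreal \<rho> * ennpowr (modulus (Lp_norm p) k f (2 * t) / ennreal ((2 * t) powr s)) q
          + ennreal C * ennpowr (modulus (Lp_norm p) (Suc k) f t / ennreal (t powr s)) q"
proof -
  \<comment> \<open>The power that leads from \<open>p\<close>-th power integrals to
    \<open>q\<close>-th powers of norms.\<close>
  define \<alpha> where "\<alpha> = q / p"
  have \<alpha>: "0 < \<alpha>" using assms by (simp add: \<alpha>_def)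
  \<comment> \<open>The factor \<open>1 + \<delta>\<close> enters once directly and once to the
    power \<open>\<alpha>\<close>. With this choice the total loss uses up half of the exponent
    \<open>(k - s) * q\<close>, and the other half gives \<open>\<rho> < 1\<close>.\<close>
  define \<delta> where "\<delta> = 2 powr ((k - s) * q / (2 * (1 + \<alpha>))) - 1"
  have \<delta>: "0 < \<delta>"
    using assms \<alpha> unfolding \<delta>_def by simp
  define \<rho> where "\<rho> = 2 powr (- ((k - s) * q / 2))"
  have \<rho>: "0 \<le> \<rho>" "\<rho> < 1"
    using assms by (auto simp: \<rho>_def powr_less_one)
  have "(k - s) * q / (2 * (1 + \<alpha>)) * (1 + \<alpha>) = (k - s) * q / 2"
    using \<alpha> by (simp add: divide_simps)
  then have "(1 + \<delta>) powr (1 + \<alpha>) = 2 powr ((k - s) * q / 2)"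
    unfolding \<delta>_def by (simp only: powr_powr diff_add_cancel add.commute[of 1 "_ - 1"])
  then have "(1 + \<delta>) * ((1 + \<delta>) / 2 powr (k * p)) powr \<alpha> = 2 powr ((k - s) * q / 2) / 2 powr (k * q)"
    using \<delta> assms by (simp add: powr_divide powr_powr \<alpha>_def powr_add)
  also have "\<dots> * 2 powr (s * q) = \<rho>"
  proof -
    have "(k - s) * q / 2 - k * q + s * q = - ((k - s) * q / 2)"
      by (simp add: field_simps)
    then show ?thesis
      unfolding \<rho>_def by (simp only: powr_add[symmetric] powr_diff[symmetric])
  qed
  finally have \<rho>_eq: "(1 + \<delta>) * ((1 + \<delta>) / 2 powr (k * p)) powr \<alpha> * 2 powr (s * q) = \<rho>" .
  obtain C1 where C1: "0 < C1"
    "\<And>f :: real ^ 'n \<Rightarrow> real. \<And>h. f \<in> borel_measurable lebesgue \<Longrightarrow>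
      power_integral p (fwd_diff k h f)
        \<le> ennreal ((1 + \<delta>) / 2 powr (k * p)) * power_integral p (fwd_diff k (2 *\<^sub>R h) f)
          + ennreal C1 * power_integral p (fwd_diff (Suc k) h f)"
    using power_integral_fwd_diff_le_double[OF \<open>0 < p\<close> \<delta>] by blast
  obtain C2 where C2: "0 < C2"
    "\<And>x y. ennpowr (x + y) \<alpha> \<le> ennreal (1 + \<delta>) * ennpowr x \<alpha> + ennreal C2 * ennpowr y \<alpha>"
    using ennpowr_add_le_eps[OF \<alpha> \<delta>] by blast
  define C where "C = C2 * C1 powr \<alpha>"
  have C: "0 < C" using C1 C2 by (simp add: C_def)
  have "ennpowr (modulus (Lp_norm p) k f t / ennreal (t powr s)) q
        \<le> ennreal \<rho> * ennpowr (modulus (Lp_norm p) k f (2 * t) / ennreal ((2 * t) powr s)) q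
          + ennreal C * ennpowr (modulus (Lp_norm p) (Suc k) f t / ennreal (t powr s)) q"
    if f: "f \<in> borel_measurable lebesgue" and t: "0 < t" for f :: "real ^ 'n \<Rightarrow> real" and t
  proof -
    define \<Phi> where "\<Phi> k t = (SUP h\<in>{h. norm h \<le> t}. power_integral p (fwd_diff k h f))" for k t
    have mod_eq: "ennpowr (modulus (Lp_norm p) k f t / ennreal (t powr s)) q
        = ennpowr (\<Phi> k t) \<alpha> / ennreal (t powr (s * q))" if "0 < t" for k t
      using that assms
      by (simp add: modulus_def Lp_norm_eq \<Phi>_def ennpowr_divide powr_powr ennpowr_ennpowr \<alpha>_def
          ennpowr_SUP[symmetric])
    \<comment> \<open>If \<open>norm h \<le> t\<close>, the doubled step has norm at most
      \<open>2 * t\<close> and is admissible in \<open>\<Phi> k (2 * t)\<close>.\<close>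
    have "\<Phi> k t \<le> ennreal ((1 + \<delta>) / 2 powr (k * p)) * \<Phi> k (2 * t) + ennreal C1 * \<Phi> (Suc k) t"
      unfolding \<Phi>_def
      by (intro SUP_least order.trans[OF C1(2)[OF f]] add_mono mult_left_mono SUP_upper) auto
    then have "ennpowr (\<Phi> k t) \<alpha>
        \<le> ennpowr (ennreal ((1 + \<delta>) / 2 powr (k * p)) * \<Phi> k (2 * t) + ennreal C1 * \<Phi> (Suc k) t) \<alpha>"
      using \<alpha> by (intro ennpowr_mono) auto
    also note C2(2)
    also have "ennreal (1 + \<delta>) * ennpowr (ennreal ((1 + \<delta>) / 2 powr (k * p)) * \<Phi> k (2 * t)) \<alpha>
        = ennreal ((1 + \<delta>) * ((1 + \<delta>) / 2 powr (k * p)) powr \<alpha>) * ennpowr (\<Phi> k (2 * t)) \<alpha>"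
      using \<delta> by (simp add: ennpowr_mult ennpowr_ennreal ennreal_mult mult_ac del: ennreal_plus)
    also have "ennreal C2 * ennpowr (ennreal C1 * \<Phi> (Suc k) t) \<alpha> = ennreal C * ennpowr (\<Phi> (Suc k) t) \<alpha>"
      using C1 C2 by (simp add: ennpowr_mult ennpowr_ennreal ennreal_mult C_def mult_ac)
    finally have "ennpowr (\<Phi> k t) \<alpha> / ennreal (t powr (s * q))
        \<le> (ennreal ((1 + \<delta>) * ((1 + \<delta>) / 2 powr (k * p)) powr \<alpha>) * ennpowr (\<Phi> k (2 * t)) \<alpha>
          + ennreal C * ennpowr (\<Phi> (Suc k) t) \<alpha>) / ennreal (t powr (s * q))"
      by (rule divide_right_mono_ennreal)
    also have "\<dots> = ennreal ((1 + \<delta>) * ((1 + \<delta>) / 2 powr (k * p)) powr \<alpha>) * (ennpowr (\<Phi> k (2 * t)) \<alpha> / ennreal (t powr (s * q)))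
          + ennreal C * (ennpowr (\<Phi> (Suc k) t) \<alpha> / ennreal (t powr (s * q)))"
      by (simp add: add_divide_distrib_ennreal ennreal_times_divide)
    \<comment> \<open>Moving the weight from \<open>t\<close> to \<open>2 * t\<close> supplies the
      factor \<open>2 powr (s * q)\<close> contained in \<open>\<rho>\<close>.\<close>
    also have "ennpowr (\<Phi> k (2 * t)) \<alpha> / ennreal (t powr (s * q))
        = ennreal (2 powr (s * q)) * (ennpowr (\<Phi> k (2 * t)) \<alpha> / ennreal ((2 * t) powr (s * q)))"
    proof (cases "ennpowr (\<Phi> k (2 * t)) \<alpha>")
      case (real r)
      then show ?thesis
        using t by (simp add: divide_ennreal ennreal_mult[symmetric] powr_mult)
    next
      case top
      then show ?thesis
        using t by (simp add: ennreal_top_divide ennreal_mult_top)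
    qed
    also have "ennreal ((1 + \<delta>) * ((1 + \<delta>) / 2 powr (k * p)) powr \<alpha>)
          * (ennreal (2 powr (s * q)) * (ennpowr (\<Phi> k (2 * t)) \<alpha> / ennreal ((2 * t) powr (s * q))))
        = ennreal \<rho> * (ennpowr (\<Phi> k (2 * t)) \<alpha> / ennreal ((2 * t) powr (s * q)))"
      using \<delta> by (simp add: \<rho>_eq[symmetric] ennreal_mult mult.assoc del: ennreal_plus)
    finally show ?thesis
      using t by (simp add: mod_eq)
  qed
  with that \<rho> C show ?thesis by blast
qed

section \<open>Lowering the order of the differences\<close>

text \<open>Finiteness of \<open>x\<close> permits subtracting \<open>\<rho> * x\<close>; for
  \<open>\<rho> > 0\<close> the value \<open>top\<close> satisfies the recursive inequality with any
  \<open>y\<close>.\<close>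

lemma ennreal_absorb:
  fixes x y :: ennreal
  assumes "x < top" "x \<le> ennreal \<rho> * x + y" "0 \<le> \<rho>" "\<rho> < 1"
  shows "x \<le> ennreal (1 / (1 - \<rho>)) * y"
proof (cases y)
  case (real b)
  obtain a where a: "x = ennreal a" "0 \<le> a"
    using assms(1) by (cases x) auto
  have "a \<le> \<rho> * a + b"
    using assms a real
    by (simp add: ennreal_mult[symmetric] ennreal_plus[symmetric] del: ennreal_plus)
  then have "a \<le> 1 / (1 - \<rho>) * b"
    using assms by (simp add: field_simps)
  then show ?thesis
    using a real assms by (simp add: ennreal_mult[symmetric] ennreal_leI)
next
  case top
  then show ?thesis
    using assms by (simp add: ennreal_mult_top)
qed

text \<open>For \<open>x \<ge> t\<close> also \<open>2 * x \<ge> t\<close>, so the recursion closes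
  on the supremum over \<open>{t..}\<close>. The decay bound makes this truncated supremum finite,
  and the bound obtained after absorption does not depend on \<open>t\<close>.\<close>

lemma SUP_absorb_doubling:
  fixes A B :: "real \<Rightarrow> ennreal"
  assumes rec: "\<And>t. 0 < t \<Longrightarrow> A t \<le> ennreal \<rho> * A (2 * t) + ennreal C * B t"
    and bound: "\<And>t. 0 < t \<Longrightarrow> A t \<le> M * ennreal (t powr - \<sigma>)"
    and "M < top" "0 \<le> \<sigma>" "0 \<le> \<rho>" "\<rho> < 1" "0 \<le> C"
  shows "(SUP t\<in>{0<..}. A t) \<le> ennreal (C / (1 - \<rho>)) * (SUP t\<in>{0<..}. B t)"
proof (rule SUP_least)
  fix t :: real assume t: "t \<in> {0<..}"
  let ?S = "SUP t\<in>{t..}. A t" and ?B = "SUP t\<in>{0<..}. B t"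
  have "?S \<le> M * ennreal (t powr - \<sigma>)"
  proof (rule SUP_least)
    fix x assume x: "x \<in> {t..}"
    have "A x \<le> M * ennreal (x powr - \<sigma>)"
      using bound[of x] x t by auto
    also have "\<dots> \<le> M * ennreal (t powr - \<sigma>)"
      using x t assms by (intro mult_left_mono ennreal_leI powr_mono2') auto
    finally show "A x \<le> M * ennreal (t powr - \<sigma>)" .
  qed
  also have "\<dots> < top"
    using \<open>M < top\<close> by (simp add: ennreal_mult_less_top)
  finally have fin: "?S < top" .
  have "?S \<le> ennreal \<rho> * ?S + ennreal C * ?B"
  proof (rule SUP_least)
    fix x assume x: "x \<in> {t..}"
    then have "A x \<le> ennreal \<rho> * A (2 * x) + ennreal C * B x"
      using rec[of x] t by auto
    also have "\<dots> \<le> ennreal \<rho> * ?S + ennreal C * ?B"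
      using x t by (intro add_mono mult_left_mono SUP_upper) auto
    finally show "A x \<le> ennreal \<rho> * ?S + ennreal C * ?B" .
  qed
  from ennreal_absorb[OF fin this] assms
  have "?S \<le> ennreal (1 / (1 - \<rho>)) * (ennreal C * ?B)" by auto
  moreover have "A t \<le> ?S" by (rule SUP_upper) auto
  ultimately show "A t \<le> ennreal (C / (1 - \<rho>)) * ?B"
    using assms by (simp add: mult.assoc[symmetric] ennreal_mult[symmetric])
qed

lemma nn_integral_powr_tail_finite:
  fixes \<sigma> \<epsilon> :: real
  assumes "0 < \<sigma>" "0 < \<epsilon>"
  shows "(\<integral>\<^sup>+t. ennreal (t powr (- \<sigma> - 1)) * indicator {\<epsilon><..} t \<partial>lborel) < top"
proof -
  have "(\<integral>\<^sup>+t. ennreal (t powr (- \<sigma> - 1)) * indicator {\<epsilon>..} t \<partial>lborel)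
      = ennreal (0 - (- (\<epsilon> powr - \<sigma>) / \<sigma>))"
  proof (rule nn_integral_FTC_atLeast)
    show "((\<lambda>t. - (t powr - \<sigma>) / \<sigma>) has_real_derivative t powr (- \<sigma> - 1)) (at t)" if "\<epsilon> \<le> t" for t
      using that assms by (auto intro!: derivative_eq_intros simp: powr_diff)
    have "((\<lambda>t. - (t powr - \<sigma>) / \<sigma>) \<longlongrightarrow> - 0 / \<sigma>) at_top"
      using assms by (intro tendsto_intros tendsto_neg_powr filterlim_ident) auto
    then show "((\<lambda>t. - (t powr - \<sigma>) / \<sigma>) \<longlongrightarrow> 0) at_top" by simp
  qed auto
  moreover have "(\<integral>\<^sup>+t. ennreal (t powr (- \<sigma> - 1)) * indicator {\<epsilon><..} t \<partial>lborel)
      \<le> (\<integral>\<^sup>+t. ennreal (t powr (- \<sigma> - 1)) * indicator {\<epsilon>..} t \<partial>lborel)"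
    by (intro nn_integral_mono) (auto split: split_indicator)
  ultimately show ?thesis
    by (metis ennreal_less_top order.strict_trans1)
qed

text \<open>The integral counterpart: \<open>dt / t\<close> is invariant under dilations, so the
  doubled argument only moves the cutoff from \<open>\<epsilon>\<close> to
  \<open>2 * \<epsilon>\<close>. The truncated integral is finite by the decay bound and can be
  absorbed; then \<open>\<epsilon>\<close> tends to 0.\<close>

lemma nn_integral_absorb_doubling:
  fixes A B :: "real \<Rightarrow> ennreal"
  assumes [measurable]: "A \<in> borel_measurable borel" "B \<in> borel_measurable borel"
    and rec: "\<And>t. 0 < t \<Longrightarrow> A t \<le> ennreal \<rho> * A (2 * t) + ennreal C * B t"
    and bound: "\<And>t. 0 < t \<Longrightarrow> A t \<le> M * ennreal (t powr - \<sigma>)"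
    and "M < top" "0 < \<sigma>" "0 \<le> \<rho>" "\<rho> < 1" "0 \<le> C"
  shows "(\<integral>\<^sup>+t\<in>{0<..}. A t / ennreal t \<partial>lborel)
    \<le> ennreal (C / (1 - \<rho>)) * (\<integral>\<^sup>+t\<in>{0<..}. B t / ennreal t \<partial>lborel)"
proof -
  let ?J = "\<lambda>\<epsilon>. \<integral>\<^sup>+t\<in>{\<epsilon><..}. A t / ennreal t \<partial>lborel"
  let ?K = "\<integral>\<^sup>+t\<in>{0<..}. B t / ennreal t \<partial>lborel"
  have J: "?J \<epsilon> \<le> ennreal (C / (1 - \<rho>)) * ?K" if \<epsilon>: "0 < \<epsilon>" for \<epsilon>
  proof -
    have "?J \<epsilon> \<le> (\<integral>\<^sup>+t. M * (ennreal (t powr (- \<sigma> - 1)) * indicator {\<epsilon><..} t) \<partial>lborel)"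
    proof (intro nn_integral_mono)
      fix t :: real
      show "A t / ennreal t * indicator {\<epsilon><..} t \<le> M * (ennreal (t powr (- \<sigma> - 1)) * indicator {\<epsilon><..} t)"
      proof (cases "\<epsilon> < t")
        case True
        have "A t / ennreal t \<le> M * ennreal (t powr - \<sigma>) / ennreal t"
          using True \<epsilon> by (intro divide_right_mono_ennreal bound) auto
        also have "\<dots> = M * ennreal (t powr (- \<sigma> - 1))"
          using True \<epsilon> by (simp add: ennreal_times_divide[symmetric] divide_ennreal powr_diff)
        finally show ?thesis using True by simp
      qed simp
    qed
    also have "\<dots> = M * (\<integral>\<^sup>+t. ennreal (t powr (- \<sigma> - 1)) * indicator {\<epsilon><..} t \<partial>lborel)"
      by (simp add: nn_integral_cmult)
    also have "\<dots> < top"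
      using \<open>M < top\<close> nn_integral_powr_tail_finite[OF \<open>0 < \<sigma>\<close> \<epsilon>] by (simp add: ennreal_mult_less_top)
    finally have fin: "?J \<epsilon> < top" .
    have "?J \<epsilon> \<le> (\<integral>\<^sup>+t. ennreal \<rho> * (A (2 * t) / ennreal t * indicator {\<epsilon><..} t)
        + ennreal C * (B t / ennreal t * indicator {0<..} t) \<partial>lborel)"
    proof (intro nn_integral_mono)
      fix t :: real
      show "A t / ennreal t * indicator {\<epsilon><..} t
        \<le> ennreal \<rho> * (A (2 * t) / ennreal t * indicator {\<epsilon><..} t)
          + ennreal C * (B t / ennreal t * indicator {0<..} t)"
      proof (cases "\<epsilon> < t")
        case True
        have "A t / ennreal t \<le> (ennreal \<rho> * A (2 * t) + ennreal C * B t) / ennreal t"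
          using True \<epsilon> by (intro divide_right_mono_ennreal rec) auto
        then show ?thesis
          using True \<epsilon> by (simp add: add_divide_distrib_ennreal ennreal_times_divide)
      qed simp
    qed
    also have "\<dots> = ennreal \<rho> * (\<integral>\<^sup>+t. A (2 * t) / ennreal t * indicator {\<epsilon><..} t \<partial>lborel) + ennreal C * ?K"
      by (simp add: nn_integral_add nn_integral_cmult)
    also have "(\<integral>\<^sup>+t. A (2 * t) / ennreal t * indicator {\<epsilon><..} t \<partial>lborel) = ?J (2 * \<epsilon>)"
    proof -
      have *: "2 * (A (2 * t) / ennreal (2 * t) * indicator {2 * \<epsilon><..} (2 * t))
        = A (2 * t) / ennreal t * indicator {\<epsilon><..} t" for t
      proof (cases "\<epsilon> < t")
        case True
        have "2 * (A (2 * t) / ennreal (2 * t)) = A (2 * t) / ennreal t"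
        proof (cases "A (2 * t)")
          case (real r)
          then show ?thesis
            using True \<epsilon> by (simp add: divide_ennreal ennreal_mult[symmetric] flip: ennreal_numeral)
        next
          case top
          then show ?thesis
            using True \<epsilon> by (simp add: ennreal_top_divide ennreal_mult_top)
        qed
        then show ?thesis using True by simp
      qed simp
      have "?J (2 * \<epsilon>) = 2 * (\<integral>\<^sup>+t. A (2 * t) / ennreal (2 * t) * indicator {2 * \<epsilon><..} (2 * t) \<partial>lborel)"
        using nn_integral_real_affine[of "\<lambda>t. A t / ennreal t * indicator {2 * \<epsilon><..} t" 2 0] by simp
      also have "\<dots> = (\<integral>\<^sup>+t. 2 * (A (2 * t) / ennreal (2 * t) * indicator {2 * \<epsilon><..} (2 * t)) \<partial>lborel)"
        by (rule nn_integral_cmult[symmetric]) measurable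
      finally show ?thesis by (simp add: *)
    qed
    also have "?J (2 * \<epsilon>) \<le> ?J \<epsilon>"
      using \<epsilon> by (intro nn_integral_mono) (auto split: split_indicator)
    finally have "?J \<epsilon> \<le> ennreal \<rho> * ?J \<epsilon> + ennreal C * ?K"
      by (simp add: add_mono mult_left_mono)
    from ennreal_absorb[OF fin this] assms show ?thesis
      by (simp add: mult.assoc[symmetric] ennreal_mult[symmetric])
  qed
  \<comment> \<open>Continuity from below of the measure with density \<open>A t / t\<close>, along
    the rays from \<open>1 / (n + 1)\<close>, removes the cutoff.\<close>
  let ?D = "density lborel (\<lambda>t. A t / ennreal t)"
  have em: "emeasure ?D {\<epsilon><..} = ?J \<epsilon>" for \<epsilon>
    by (simp add: emeasure_density)
  have "{0<..} = (\<Union>n. {1 / real (Suc n)<..})"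
  proof (intro equalityI subsetI)
    fix x :: real assume "x \<in> {0<..}"
    then show "x \<in> (\<Union>n. {1 / real (Suc n)<..})"
      using nat_approx_posE[of x] by auto
  qed (auto intro: less_trans[rotated])
  then have "?J 0 = emeasure ?D (\<Union>n. {1 / real (Suc n)<..})"
    using em[of 0] by simp
  also have "\<dots> = (SUP n. emeasure ?D {1 / real (Suc n)<..})"
    by (intro SUP_emeasure_incseq[symmetric])
      (auto simp: incseq_def intro: order.strict_trans1[rotated] intro!: divide_left_mono)
  also have "\<dots> \<le> ennreal (C / (1 - \<rho>)) * ?K"
    unfolding em by (intro SUP_least J) simp
  finally show ?thesis .
qed

text \<open>The Besov functional with the order of the differences decoupled from the smoothness,
  because \<open>s\<close> and the smaller smoothness \<open>s * (r / p)\<close> may have different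
  minimal orders.\<close>

definition besov_order :: "((real ^ 'n \<Rightarrow> real) \<Rightarrow> ennreal) \<Rightarrow> nat \<Rightarrow> real \<Rightarrow> ennreal
    \<Rightarrow> (real ^ 'n \<Rightarrow> real) \<Rightarrow> ennreal" where
  "besov_order M k s q f =
    (if q = top
     then (SUP t\<in>{0<..}. modulus M k f t / ennreal (t powr s))
     else ennpowr
       (\<integral>\<^sup>+ t\<in>{0<..}. ennpowr (modulus M k f t / ennreal (t powr s)) (enn2real q)
                       / ennreal t \<partial>lborel)
       (1 / enn2real q))"

lemma besov_functional_eq: "besov_functional M s q f = besov_order M (diff_order s) s q f"
  by (simp add: besov_functional_def besov_order_def)

text \<open>A finite \<open>Lp_norm\<close> bounds the modulus uniformly in \<open>t\<close>, so the
  quotient decays like \<open>t powr - s\<close>. This is the decay needed to absorb the doubled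
  term of \<open>marchaud_pointwise\<close>.\<close>

lemma besov_order_Suc:
  fixes p s :: real and q :: ennreal
  assumes "0 < p" "0 < q" "0 < s" "s < real k"
  obtains C where "0 < C"
    "\<And>f :: real ^ 'n \<Rightarrow> real. f \<in> borel_measurable lebesgue \<Longrightarrow> Lp_norm p f < top \<Longrightarrow>
      besov_order (Lp_norm p) k s q f \<le> ennreal C * besov_order (Lp_norm p) (Suc k) s q f"
proof -
  \<comment> \<open>For \<open>q = top\<close> no power is integrated, and the exponent 1 leaves the
    quotient unchanged under the supremum.\<close>
  define r where "r = (if q = top then 1 else enn2real q)"
  have r: "0 < r"
    using assms by (auto simp: r_def enn2real_positive_iff less_top)
  obtain \<rho> C where \<rho>: "0 \<le> \<rho>" "\<rho> < 1" and C: "0 < C"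
    and rec: "\<And>f :: real ^ 'n \<Rightarrow> real. \<And>t. f \<in> borel_measurable lebesgue \<Longrightarrow> 0 < t \<Longrightarrow>
      ennpowr (modulus (Lp_norm p) k f t / ennreal (t powr s)) r
        \<le> ennreal \<rho> * ennpowr (modulus (Lp_norm p) k f (2 * t) / ennreal ((2 * t) powr s)) r
          + ennreal C * ennpowr (modulus (Lp_norm p) (Suc k) f t / ennreal (t powr s)) r"
    using marchaud_pointwise[OF assms(1) r assms(4)] by metis
  define D where "D = C / (1 - \<rho>)"
  have D: "0 < D" using C \<rho> by (simp add: D_def)
  have main: "besov_order (Lp_norm p) k s q f \<le> ennreal (D powr (1 / r)) * besov_order (Lp_norm p) (Suc k) s q f"
    if f: "f \<in> borel_measurable lebesgue" and fin: "Lp_norm p f < top" for f :: "real ^ 'n \<Rightarrow> real"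
  proof -
    let ?A = "\<lambda>k t. ennpowr (modulus (Lp_norm p) k f t / ennreal (t powr s)) r"
    define M where "M = ennreal (((2 * 2 powr p) ^ k) powr (1 / p)) * Lp_norm p f"
    have M: "ennpowr M r < top"
      using fin by (simp add: M_def ennreal_mult_less_top)
    have bound: "?A k t \<le> ennpowr M r * ennreal (t powr - (s * r))" if t: "0 < t" for t
    proof -
      have "?A k t \<le> ennpowr (M / ennreal (t powr s)) r"
        unfolding M_def using r
        by (intro ennpowr_mono divide_right_mono_ennreal modulus_Lp_le f assms) auto
      also have "\<dots> = ennpowr M r / ennreal (t powr (s * r))"
        using t by (simp add: ennpowr_divide powr_powr)
      also have "\<dots> = ennpowr M r * ennreal (t powr - (s * r))"
        using t by (simp add: divide_ennreal_def inverse_ennreal powr_minus)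
      finally show ?thesis .
    qed
    have sr: "0 < s * r" using assms r by simp
    have [measurable]: "?A k \<in> borel_measurable borel" for k
      by measurable
    show ?thesis
    proof (cases "q = top")
      case True
      then have r1: "r = 1" by (simp add: r_def)
      have "(SUP t\<in>{0<..}. ?A k t) \<le> ennreal D * (SUP t\<in>{0<..}. ?A (Suc k) t)"
        unfolding D_def using \<rho> C M sr by (intro SUP_absorb_doubling[OF rec[OF f] bound]) auto
      then show ?thesis
        using True D by (simp add: besov_order_def r1)
    next
      case False
      have "(\<integral>\<^sup>+t\<in>{0<..}. ?A k t / ennreal t \<partial>lborel)
        \<le> ennreal D * (\<integral>\<^sup>+t\<in>{0<..}. ?A (Suc k) t / ennreal t \<partial>lborel)"
        unfolding D_def using \<rho> C M sr
        by (intro nn_integral_absorb_doubling[OF _ _ rec[OF f] bound]) auto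
      then have "ennpowr (\<integral>\<^sup>+t\<in>{0<..}. ?A k t / ennreal t \<partial>lborel) (1 / r)
        \<le> ennpowr (ennreal D * (\<integral>\<^sup>+t\<in>{0<..}. ?A (Suc k) t / ennreal t \<partial>lborel)) (1 / r)"
        using r by (intro ennpowr_mono) auto
      then show ?thesis
        using False D by (simp add: besov_order_def r_def ennpowr_mult ennpowr_ennreal)
    qed
  qed
  have "0 < D powr (1 / r)" using D by simp
  from that[OF this main] show ?thesis .
qed

text \<open>The condition \<open>s < k\<close> persists as the order grows, so the order can be
  raised one at a time.\<close>

lemma besov_order_le:
  fixes p s :: real and q :: ennreal
  assumes "0 < p" "0 < q" "0 < s" "s < real k" "k \<le> K"
  obtains C where "0 < C"
    "\<And>f :: real ^ 'n \<Rightarrow> real. f \<in> borel_measurable lebesgue \<Longrightarrow> Lp_norm p f < top \<Longrightarrow>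
      besov_order (Lp_norm p) k s q f \<le> ennreal C * besov_order (Lp_norm p) K s q f"
proof -
  have "\<exists>C>0. \<forall>f :: real ^ 'n \<Rightarrow> real. f \<in> borel_measurable lebesgue \<longrightarrow> Lp_norm p f < top \<longrightarrow>
      besov_order (Lp_norm p) k s q f \<le> ennreal C * besov_order (Lp_norm p) K s q f"
    using \<open>k \<le> K\<close>
  proof (induction K rule: dec_induct)
    case base
    show ?case by (intro exI[of _ 1]) auto
  next
    case (step K)
    then obtain C where C: "0 < C" "\<forall>f :: real ^ 'n \<Rightarrow> real. f \<in> borel_measurable lebesgue \<longrightarrow>
      Lp_norm p f < top \<longrightarrow>
      besov_order (Lp_norm p) k s q f \<le> ennreal C * besov_order (Lp_norm p) K s q f" by blast
    have "s < real K" using assms step by linarith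
    then obtain D where D: "0 < D"
      "\<And>f :: real ^ 'n \<Rightarrow> real. f \<in> borel_measurable lebesgue \<Longrightarrow> Lp_norm p f < top \<Longrightarrow>
        besov_order (Lp_norm p) K s q f \<le> ennreal D * besov_order (Lp_norm p) (Suc K) s q f"
      using besov_order_Suc[of p q s K] assms by metis
    show ?case
    proof (intro exI[of _ "C * D"] conjI allI impI)
      fix f :: "real ^ 'n \<Rightarrow> real"
      assume f: "f \<in> borel_measurable lebesgue" "Lp_norm p f < top"
      have "besov_order (Lp_norm p) k s q f \<le> ennreal C * besov_order (Lp_norm p) K s q f"
        using C f by blast
      also have "\<dots> \<le> ennreal C * (ennreal D * besov_order (Lp_norm p) (Suc K) s q f)"
        by (intro mult_left_mono D f) auto
      finally show "besov_order (Lp_norm p) k s q f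
          \<le> ennreal (C * D) * besov_order (Lp_norm p) (Suc K) s q f"
        using C D by (simp add: ennreal_mult mult.assoc)
    qed (use C D in auto)
  qed
  with that show ?thesis by blast
qed

section \<open>Dyadic cubes\<close>

declare emeasure_completion [simp del]

text \<open>For \<open>L > 0\<close>, the half-open cubes of side \<open>L / 2 ^ n\<close> in a grid
  through the origin. They are named by a point instead of lattice indices: with \<open>x\<close>
  fixed and \<open>n\<close> decreasing, they run through the ancestors of a cube.\<close>

definition dyadic :: "real \<Rightarrow> nat \<Rightarrow> real ^ 'n \<Rightarrow> (real ^ 'n) set" where
  "dyadic L n x = {y. \<forall>i. \<lfloor>2 ^ n * (y $ i) / L\<rfloor> = \<lfloor>2 ^ n * (x $ i) / L\<rfloor>}"

lemma mem_dyadic_self [simp]: "x \<in> dyadic L n x"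
  by (simp add: dyadic_def)

lemma dyadic_eq: "y \<in> dyadic L n x \<Longrightarrow> dyadic L n y = dyadic L n x"
  by (simp add: dyadic_def)

text \<open>One coordinate of dyadic nesting: the index of the parent interval is the integer half
  of the index of the child.\<close>

lemma floor_eq_floor_double_div: "\<lfloor>a\<rfloor> = \<lfloor>2 * a\<rfloor> div 2" for a :: real
proof (rule floor_unique)
  let ?m = "\<lfloor>2 * a\<rfloor>"
  have "?m = 2 * (?m div 2) + ?m mod 2" "?m mod 2 \<ge> 0" "?m mod 2 \<le> 1"
    by auto
  then have "2 * (?m div 2) \<le> ?m" "?m \<le> 2 * (?m div 2) + 1"
    by linarith+
  then have *: "2 * real_of_int (?m div 2) \<le> real_of_int ?m"
    "real_of_int ?m \<le> 2 * real_of_int (?m div 2) + 1"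
    by linarith+
  show "real_of_int (?m div 2) \<le> a" "a < real_of_int (?m div 2) + 1"
    using * by linarith+
qed

lemma dyadic_Suc_subset: "dyadic L (Suc n) x \<subseteq> dyadic L n x"
proof
  fix y assume y: "y \<in> dyadic L (Suc n) x"
  have "2 * (2 ^ n * z / L) = 2 ^ Suc n * z / L" for z by simp
  then show "y \<in> dyadic L n x"
    using y unfolding dyadic_def mem_Collect_eq
    by (simp only: floor_eq_floor_double_div[of "2 ^ n * _ / L"]) simp
qed

lemma dyadic_antimono: "m \<le> n \<Longrightarrow> dyadic L n x \<subseteq> dyadic L m x"
  by (induction rule: dec_induct) (use dyadic_Suc_subset in blast)+

lemma countable_dyadic: "countable {dyadic L n x | n x. True}"
proof -
  let ?D = "\<lambda>(n, k :: int ^ 'n). {y :: real ^ 'n. \<forall>i. \<lfloor>2 ^ n * (y $ i) / L\<rfloor> = k $ i}"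
  have "dyadic L n x \<in> range ?D" for n and x :: "real ^ 'n"
    by (rule range_eqI[of _ _ "(n, \<chi> i. \<lfloor>2 ^ n * (x $ i) / L\<rfloor>)"]) (simp add: dyadic_def)
  then have "{dyadic L n x | n x. True} \<subseteq> range ?D" by blast
  then show ?thesis
    by (rule countable_subset) simp
qed

text \<open>The two boxes have equal measure, which determines that of the half-open cube; the
  closed one is a cube as used in \<open>BMO_norm\<close>.\<close>

lemma dyadic_sandwich:
  fixes x :: "real ^ 'n"
  assumes "0 < L"
  obtains a where
    "box a (\<chi> i. a $ i + L / 2 ^ n) \<subseteq> dyadic L n x"
    "dyadic L n x \<subseteq> cbox a (\<chi> i. a $ i + L / 2 ^ n)"
proof
  let ?a = "\<chi> i. L / 2 ^ n * of_int \<lfloor>2 ^ n * (x $ i) / L\<rfloor> :: real ^ 'n"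
  show "box ?a (\<chi> i. ?a $ i + L / 2 ^ n) \<subseteq> dyadic L n x"
  proof
    fix y assume y: "y \<in> box ?a (\<chi> i. ?a $ i + L / 2 ^ n)"
    show "y \<in> dyadic L n x"
      unfolding dyadic_def mem_Collect_eq
    proof
      fix i
      have "L / 2 ^ n * of_int \<lfloor>2 ^ n * (x $ i) / L\<rfloor> < y $ i"
        "y $ i < L / 2 ^ n * of_int \<lfloor>2 ^ n * (x $ i) / L\<rfloor> + L / 2 ^ n"
        using y by (auto simp: mem_box_cart)
      then show "\<lfloor>2 ^ n * (y $ i) / L\<rfloor> = \<lfloor>2 ^ n * (x $ i) / L\<rfloor>"
        using assms by (intro floor_unique) (auto simp: field_simps)
    qed
  qed
  show "dyadic L n x \<subseteq> cbox ?a (\<chi> i. ?a $ i + L / 2 ^ n)"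
  proof
    fix y assume y: "y \<in> dyadic L n x"
    show "y \<in> cbox ?a (\<chi> i. ?a $ i + L / 2 ^ n)"
      unfolding mem_box_cart
    proof (intro allI)
      fix i
      have "\<lfloor>2 ^ n * (x $ i) / L\<rfloor> = \<lfloor>2 ^ n * (y $ i) / L\<rfloor>"
        using y by (simp add: dyadic_def)
      then have "of_int \<lfloor>2 ^ n * (x $ i) / L\<rfloor> \<le> 2 ^ n * (y $ i) / L"
        "2 ^ n * (y $ i) / L < of_int \<lfloor>2 ^ n * (x $ i) / L\<rfloor> + 1"
        by linarith+
      then show "?a $ i \<le> y $ i \<and> y $ i \<le> (\<chi> i. ?a $ i + L / 2 ^ n) $ i"
        using assms by (simp add: field_simps)
    qed
  qed
qed

lemma dyadic_borel [measurable]: "dyadic L n x \<in> sets borel"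
proof -
  have "{y \<in> space borel. \<forall>i\<in>UNIV. \<lfloor>2 ^ n * (y $ i) / L\<rfloor> = \<lfloor>2 ^ n * (x $ i) / L\<rfloor>} \<in> sets borel"
    by measurable
  then show ?thesis
    by (simp add: dyadic_def)
qed

lemma dyadic_lebesgue [measurable]: "dyadic L n x \<in> sets lebesgue"
  by (simp add: dyadic_borel)

lemma emeasure_lebesgue_cube:
  fixes a :: "real ^ 'n"
  assumes "0 \<le> l"
  shows "emeasure lebesgue (cbox a (\<chi> i. a $ i + l)) = ennreal (l ^ CARD('n))"
    and "emeasure lebesgue (box a (\<chi> i. a $ i + l)) = ennreal (l ^ CARD('n))"
proof -
  let ?b = "\<chi> i. a $ i + l"
  have le: "a \<bullet> b \<le> ?b \<bullet> b" and eq: "(?b - a) \<bullet> b = l" if b: "b \<in> Basis" for b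
  proof -
    obtain i where "b = axis i 1" using b by (auto simp: Basis_vec_def)
    then show "a \<bullet> b \<le> ?b \<bullet> b" "(?b - a) \<bullet> b = l"
      using assms by (auto simp: inner_axis)
  qed
  have "(\<Prod>b\<in>Basis. (?b - a) \<bullet> b) = l ^ CARD('n)"
    by (simp add: eq)
  with le show "emeasure lebesgue (cbox a ?b) = ennreal (l ^ CARD('n))"
    "emeasure lebesgue (box a ?b) = ennreal (l ^ CARD('n))"
    by (simp_all add: emeasure_completion emeasure_lborel_cbox emeasure_lborel_box)
qed

lemma emeasure_dyadic:
  fixes x :: "real ^ 'n"
  assumes "0 < L"
  shows "emeasure lebesgue (dyadic L n x) = ennreal ((L / 2 ^ n) ^ CARD('n))"
proof -
  obtain a where a: "box a (\<chi> i. a $ i + L / 2 ^ n) \<subseteq> dyadic L n x"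
    "dyadic L n x \<subseteq> cbox a (\<chi> i. a $ i + L / 2 ^ n)"
    using dyadic_sandwich[OF assms] by blast
  have l: "0 \<le> L / 2 ^ n" using assms by simp
  show ?thesis
    using emeasure_mono[OF a(1), of lebesgue] emeasure_mono[OF a(2), of lebesgue]
    unfolding emeasure_lebesgue_cube[OF l] by (simp add: antisym)
qed

lemma dyadic_subset_open:
  fixes x :: "real ^ 'n"
  assumes "0 < L" "open U" "x \<in> U"
  shows "\<exists>n. dyadic L n x \<subseteq> U"
proof -
  obtain e where e: "0 < e" "ball x e \<subseteq> U"
    using assms open_contains_ball by blast
  \<comment> \<open>The sum of the coordinate distances dominates the Euclidean distance, and each
    of them is at most the side length.\<close>
  have "\<exists>n. real CARD('n) * L / e < 2 ^ n"
    using real_arch_pow[of 2] by simp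
  then obtain n where n: "real CARD('n) * (L / 2 ^ n) < e"
    using e by (auto simp: field_simps)
  have "dyadic L n x \<subseteq> ball x e"
  proof
    fix y assume y: "y \<in> dyadic L n x"
    have "\<bar>(x - y) $ i\<bar> \<le> L / 2 ^ n" for i
    proof -
      have "\<lfloor>2 ^ n * (x $ i) / L\<rfloor> = \<lfloor>2 ^ n * (y $ i) / L\<rfloor>"
        using y by (simp add: dyadic_def)
      then have "\<bar>2 ^ n * (x $ i) / L - 2 ^ n * (y $ i) / L\<bar> \<le> 1"
        by linarith
      then have "\<bar>(2 ^ n / L) * (x $ i - y $ i)\<bar> \<le> 1"
        by (simp add: algebra_simps diff_divide_distrib)
      then show ?thesis
        using assms by (simp add: abs_mult divide_simps mult.commute)
    qed
    then have "(\<Sum>i\<in>UNIV. \<bar>(x - y) $ i\<bar>) \<le> real CARD('n) * (L / 2 ^ n)"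
      by (intro sum_bounded_above) auto
    with norm_le_l1_cart[of "x - y"] n show "y \<in> ball x e"
      by (simp add: dist_norm)
  qed
  with e show ?thesis by blast
qed

text \<open>The maximal dyadic cubes satisfying \<^term>\<open>P\<close>, the coarsest generation being number 0.\<close>
definition stopped :: "real \<Rightarrow> ((real ^ 'n) set \<Rightarrow> bool) \<Rightarrow> (real ^ 'n) set set" where
  "stopped L P = {dyadic L n x | n x. P (dyadic L n x) \<and> (\<forall>m<n. \<not> P (dyadic L m x))}"

lemma countable_stopped: "countable (stopped L P)"
  by (rule countable_subset[OF _ countable_dyadic[of L]]) (auto simp: stopped_def)

lemma stopped_lebesgue: "Q \<in> stopped L P \<Longrightarrow> Q \<in> sets lebesgue"
  by (auto simp: stopped_def)

lemma Union_stopped: "\<Union>(stopped L P) = {x. \<exists>n. P (dyadic L n x)}"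
proof (intro equalityI subsetI)
  fix y assume "y \<in> \<Union>(stopped L P)"
  then show "y \<in> {x. \<exists>n. P (dyadic L n x)}"
    by (auto simp: stopped_def) (metis dyadic_eq)
next
  fix x assume "x \<in> {x. \<exists>n. P (dyadic L n x)}"
  then have "P (dyadic L (LEAST n. P (dyadic L n x)) x)" 
    by (auto intro: LeastI_ex)
  moreover have "\<forall>m<(LEAST n. P (dyadic L n x)). \<not> P (dyadic L m x)"
    using not_less_Least by blast
  ultimately have "dyadic L (LEAST n. P (dyadic L n x)) x \<in> stopped L P"
    unfolding stopped_def by blast
  then show "x \<in> \<Union>(stopped L P)"
    by (meson UnionI mem_dyadic_self)
qed

text \<open>Each generation has one cube through a given point \<open>z\<close>, and a maximal cube
  containing \<open>z\<close> belongs to the first generation at which \<open>P\<close> holds around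
  \<open>z\<close>. Hence maximal cubes with a common point coincide.\<close>

lemma disjoint_stopped: "disjoint (stopped L P)"
proof (rule disjointI)
  fix Q R assume Q: "Q \<in> stopped L P" and R: "R \<in> stopped L P" and ne: "Q \<noteq> R"
  show "Q \<inter> R = {}"
  proof (rule ccontr)
    assume "Q \<inter> R \<noteq> {}"
    then obtain z where z: "z \<in> Q" "z \<in> R" by blast
    have at_z: "\<exists>n. S = dyadic L n z \<and> P (dyadic L n z) \<and> (\<forall>m<n. \<not> P (dyadic L m z))"
      if S: "S \<in> stopped L P" "z \<in> S" for S
    proof -
      obtain n x where nx: "S = dyadic L n x" "P (dyadic L n x)" "\<forall>m<n. \<not> P (dyadic L m x)"
        using S by (auto simp: stopped_def)
      have "dyadic L m z = dyadic L m x" if "m \<le> n" for m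
        using dyadic_antimono[OF that, of L x] S nx by (intro dyadic_eq) auto
      with nx show ?thesis by (metis less_imp_le order_refl)
    qed
    from at_z[OF Q z(1)] at_z[OF R z(2)] ne show False
      by (metis linorder_neqE_nat)
  qed
qed

text \<open>Estimates on countably many disjoint pieces add up; an integral against counting measure
  on \<open>\<Q>\<close> serves as the sum.\<close>

lemma emeasure_Int_Union_le:
  assumes "countable \<Q>" "disjoint \<Q>" "\<And>Q. Q \<in> \<Q> \<Longrightarrow> Q \<in> sets M"
    and [measurable]: "A \<in> sets M" "B \<in> sets M"
    and le: "\<And>Q. Q \<in> \<Q> \<Longrightarrow> c * emeasure M (A \<inter> Q) \<le> d * emeasure M (B \<inter> Q)"
  shows "c * emeasure M (A \<inter> \<Union>\<Q>) \<le> d * emeasure M (B \<inter> \<Union>\<Q>)"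
proof -
  have *: "emeasure M (S \<inter> \<Union>\<Q>) = (\<integral>\<^sup>+Q. emeasure M (S \<inter> Q) \<partial>count_space \<Q>)"
    if [measurable]: "S \<in> sets M" for S
  proof -
    have "emeasure M (\<Union>((\<lambda>Q. S \<inter> Q) ` \<Q>)) = (\<integral>\<^sup>+Q. emeasure M (S \<inter> Q) \<partial>count_space \<Q>)"
      using assms(1-3)
      by (intro emeasure_UN_countable) (auto simp: disjoint_family_on_def disjoint_def)
    moreover have "\<Union>((\<lambda>Q. S \<inter> Q) ` \<Q>) = S \<inter> \<Union>\<Q>" by auto
    ultimately show ?thesis by simp
  qed
  show ?thesis
    unfolding *[OF assms(4)] *[OF assms(5)] using le
    by (subst (1 2) nn_integral_cmult[symmetric]) (auto intro!: nn_integral_mono)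
qed

lemma ennreal_le_ennrealE:
  assumes "x \<le> ennreal w"
  obtains b where "x = ennreal b" "0 \<le> b"
  using assms by (cases x) (auto simp: top_unique)

text \<open>A substitute for the Lebesgue density theorem. Every dyadic cube meeting the uncovered
  part \<open>F\<close> is at most half filled by \<open>E\<close>. Splitting an open
  \<open>U\<close> around \<open>F\<close>, with \<open>U - F\<close> of measure less than
  \<open>e\<close>, into dyadic cubes shows that twice the measure of \<open>F\<close> is at most
  that of \<open>U\<close>. As \<open>F\<close> has finite measure, its measure is at most
  \<open>e\<close>.\<close>

lemma emeasure_outside_dense_dyadic:
  fixes E :: "(real ^ 'n) set"
  assumes "0 < L" and E [measurable]: "E \<in> sets lebesgue" and fin: "emeasure lebesgue E < top"
  defines "P \<equiv> \<lambda>Q. emeasure lebesgue Q < 2 * emeasure lebesgue (E \<inter> Q)"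
  shows "emeasure lebesgue (E - \<Union>(stopped L P)) = 0"
proof -
  have [measurable]: "\<Union>(stopped L P) \<in> sets lebesgue"
    using countable_stopped stopped_lebesgue by (intro sets.countable_Union) auto
  define F where "F = E - \<Union>(stopped L P)"
  have F [measurable]: "F \<in> sets lebesgue" by (simp add: F_def)
  have Ffin: "emeasure lebesgue F < top"
    using fin emeasure_mono[of F E lebesgue] by (auto simp: F_def intro: order.strict_trans1)
  have "emeasure lebesgue F \<le> 0 + ennreal e" if e: "0 < e" for e
  proof -
    obtain U where U: "open U" "F \<subseteq> U" "U - F \<in> lmeasurable" "emeasure lebesgue (U - F) < ennreal e"
      using sets_lebesgue_outer_open[OF F e] by blast
    let ?\<Q> = "stopped L (\<lambda>Q. Q \<subseteq> U)"
    have UQ: "\<Union>?\<Q> = U"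
    proof
      show "U \<subseteq> \<Union>?\<Q>"
        using dyadic_subset_open[OF \<open>0 < L\<close> U(1)] by (auto simp: Union_stopped)
      show "\<Union>?\<Q> \<subseteq> U"
        unfolding Union_stopped using mem_dyadic_self by blast
    qed
    have "2 * emeasure lebesgue (F \<inter> \<Union>?\<Q>) \<le> 1 * emeasure lebesgue (UNIV \<inter> \<Union>?\<Q>)"
    proof (rule emeasure_Int_Union_le[OF countable_stopped disjoint_stopped stopped_lebesgue])
      fix Q assume Q: "Q \<in> ?\<Q>"
      show "2 * emeasure lebesgue (F \<inter> Q) \<le> 1 * emeasure lebesgue (UNIV \<inter> Q)"
      proof (cases "F \<inter> Q = {}")
        case False
        then obtain x where x: "x \<in> F" "x \<in> Q" by blast
        then obtain n where n: "Q = dyadic L n x"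
          using Q by (auto simp: stopped_def dest: dyadic_eq)
        then have [measurable]: "Q \<in> sets lebesgue" by simp
        \<comment> \<open>The point \<open>x\<close> of \<open>F\<close> lies in no maximal cube, so
          no dyadic cube around it satisfies \<open>P\<close>.\<close>
        have "\<not> P Q"
          using x n by (auto simp: F_def Union_stopped)
        then have "2 * emeasure lebesgue (E \<inter> Q) \<le> emeasure lebesgue Q"
          by (simp add: P_def not_less)
        moreover have "emeasure lebesgue (F \<inter> Q) \<le> emeasure lebesgue (E \<inter> Q)"
          by (intro emeasure_mono) (auto simp: F_def)
        ultimately show ?thesis
          by (simp add: order.trans[OF mult_left_mono])
      qed simp
    qed auto
    then have "emeasure lebesgue F + emeasure lebesgue F \<le> emeasure lebesgue U"
      using U(2) by (simp add: UQ Int_absorb2 mult_2)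
    also have "\<dots> = emeasure lebesgue F + emeasure lebesgue (U - F)"
      using U by (subst plus_emeasure) (auto simp: Un_absorb1)
    finally have "emeasure lebesgue F \<le> emeasure lebesgue (U - F)"
      using Ffin by (auto simp: ennreal_add_left_cancel_le)
    with U(4) show ?thesis by simp
  qed
  then have "emeasure lebesgue F \<le> 0"
    by (rule ennreal_le_epsilon)
  then show ?thesis by (simp add: F_def)
qed

section \<open>Interpolation between BMO and weak Lebesgue spaces\<close>

lemma BMO_norm_cube:
  fixes f :: "real ^ 'n \<Rightarrow> real" and a :: "real ^ 'n"
  assumes "0 < l"
  defines "C \<equiv> cbox a (\<chi> i. a $ i + l)"
  shows "(\<integral>\<^sup>+x\<in>C. (\<integral>\<^sup>+z\<in>C. ennreal \<bar>f z - f x\<bar> \<partial>lebesgue) \<partial>lebesgue)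
    \<le> BMO_norm f * ennreal ((l ^ CARD('n))\<^sup>2)"
proof -
  let ?I = "\<integral>\<^sup>+x\<in>C. (\<integral>\<^sup>+z\<in>C. ennreal \<bar>f z - f x\<bar> \<partial>lebesgue) \<partial>lebesgue"
  have C: "C \<in> cubes" using assms by (auto simp: cubes_def)
  have v: "(emeasure lebesgue C)\<^sup>2 = ennreal ((l ^ CARD('n))\<^sup>2)"
    using assms by (simp add: C_def emeasure_lebesgue_cube ennreal_power)
  have "?I / ennreal ((l ^ CARD('n))\<^sup>2) \<le> BMO_norm f"
    unfolding BMO_norm_def v[symmetric] by (rule SUP_upper[OF C])
  then have "?I / ennreal ((l ^ CARD('n))\<^sup>2) * ennreal ((l ^ CARD('n))\<^sup>2)
      \<le> BMO_norm f * ennreal ((l ^ CARD('n))\<^sup>2)"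
    by (rule mult_right_mono) simp
  moreover have "?I / ennreal ((l ^ CARD('n))\<^sup>2) * ennreal ((l ^ CARD('n))\<^sup>2) = ?I"
    using assms(1) by (simp only: ennreal_divide_times ennreal_divide_self) simp
  ultimately show ?thesis by simp
qed

text \<open>On the parent of a maximal cube that is more than half filled by \<open>{|f| > t}\<close>, the set
  \<open>{|f| \<le> t}\<close> has at least half of the measure, and there \<^term>\<open>f\<close> differs by at least \<^term>\<open>t\<close>
  from its values on \<open>{|f| > 2 t}\<close>.\<close>
lemma BMO_distribution_doubling:
  fixes f :: "real ^ 'n \<Rightarrow> real"
  assumes [measurable]: "f \<in> borel_measurable lebesgue" and t: "0 < t"
    and fin: "emeasure lebesgue {x. \<bar>f x\<bar> > t} < top"
  shows "ennreal t * emeasure lebesgue {x. \<bar>f x\<bar> > 2 * t}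
    \<le> ennreal (2 ^ (CARD('n) + 2)) * BMO_norm f * emeasure lebesgue {x. \<bar>f x\<bar> > t}"
proof -
  define E where "E = {x. \<bar>f x\<bar> > t}"
  define E2 where "E2 = {x. \<bar>f x\<bar> > 2 * t}"
  have "{x \<in> space lebesgue. \<bar>f x\<bar> > t} \<in> sets lebesgue" "{x \<in> space lebesgue. \<bar>f x\<bar> > 2 * t} \<in> sets lebesgue"
    by measurable
  then have E [measurable]: "E \<in> sets lebesgue" "E2 \<in> sets lebesgue"
    by (simp_all add: E_def E2_def)
  have Efin: "emeasure lebesgue E < top" using fin by (simp add: E_def)
  then obtain m where m: "emeasure lebesgue E = ennreal m" "0 \<le> m"
    by (cases "emeasure lebesgue E") auto
  \<comment> \<open>Cubes of generation 0 then have at least twice the measure of \<open>E\<close>,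
    so none satisfies \<open>P\<close> and every maximal cube has a parent. The summand 1 ensures
    \<open>1 \<le> L\<close>, whence \<open>L \<le> L ^ CARD('n)\<close>.\<close>
  define L where "L = 2 * m + 1"
  have L: "0 < L" "2 * m \<le> L ^ CARD('n)"
    using m self_le_power[of L "CARD('n)"] by (auto simp: L_def)
  define P where "P = (\<lambda>Q. emeasure lebesgue Q < 2 * emeasure lebesgue (E \<inter> Q))"
  let ?\<Q> = "stopped L P"
  have [measurable]: "\<Union>?\<Q> \<in> sets lebesgue"
    using countable_stopped stopped_lebesgue by (intro sets.countable_Union) auto
  have "emeasure lebesgue (E - \<Union>?\<Q>) = 0"
    unfolding P_def by (rule emeasure_outside_dense_dyadic[OF L(1) E(1) Efin])
  moreover have "E2 \<subseteq> E" using t by (auto simp: E_def E2_def)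
  ultimately have "emeasure lebesgue (E2 - \<Union>?\<Q>) = 0"
    using emeasure_mono[of "E2 - \<Union>?\<Q>" "E - \<Union>?\<Q>" lebesgue] by auto
  then have E2: "emeasure lebesgue E2 = emeasure lebesgue (E2 \<inter> \<Union>?\<Q>)"
    using plus_emeasure[of "E2 \<inter> \<Union>?\<Q>" lebesgue "E2 - \<Union>?\<Q>"] by (auto simp: Int_Diff_Un Int_Diff_disjoint)
  have "ennreal t * emeasure lebesgue (E2 \<inter> \<Union>?\<Q>)
      \<le> (ennreal (2 ^ (CARD('n) + 2)) * BMO_norm f) * emeasure lebesgue (E \<inter> \<Union>?\<Q>)"
  proof (rule emeasure_Int_Union_le[OF countable_stopped disjoint_stopped stopped_lebesgue])
    fix Q assume "Q \<in> ?\<Q>"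
    then obtain n x where Q: "Q = dyadic L n x" "P Q" and nP: "\<And>m. m < n \<Longrightarrow> \<not> P (dyadic L m x)"
      by (auto simp: stopped_def)
    have "\<not> P (dyadic L 0 x)"
    proof -
      have "emeasure lebesgue (E \<inter> dyadic L 0 x) \<le> ennreal m"
        using emeasure_mono[of "E \<inter> dyadic L 0 x" E lebesgue] m by auto
      then have "2 * emeasure lebesgue (E \<inter> dyadic L 0 x) \<le> 2 * ennreal m"
        by (intro mult_left_mono) auto
      also have "\<dots> = ennreal (2 * m)" using m by (simp add: ennreal_mult)
      also have "\<dots> \<le> ennreal (L ^ CARD('n))"
        using L by (intro ennreal_leI)
      finally show ?thesis
        using L by (simp add: P_def emeasure_dyadic not_less)
    qed
    then obtain n' where n': "n = Suc n'"
      using Q by (cases n) auto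
    define R where "R = dyadic L n' x"
    have "\<not> P R" using nP n' by (simp add: R_def)
    define l where "l = L / 2 ^ n'"
    define w where "w = l ^ CARD('n)"
    have l: "0 < l" using L by (simp add: l_def)
    have w: "0 < w" using l by (simp add: w_def)
    have QR: "Q \<subseteq> R" unfolding Q R_def n' by (rule dyadic_Suc_subset)
    have [measurable]: "Q \<in> sets lebesgue" "R \<in> sets lebesgue"
      by (simp_all add: Q R_def)
    have R_eq: "emeasure lebesgue R = ennreal w"
      using L by (simp add: R_def emeasure_dyadic w_def l_def)
    have "(L / 2 ^ n) ^ CARD('n) = w / 2 ^ CARD('n)"
      by (simp add: n' w_def l_def power_divide power_mult_distrib)
    then have Q_eq: "emeasure lebesgue Q = ennreal (w / 2 ^ CARD('n))"
      using L by (simp add: Q emeasure_dyadic)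
    obtain a where a: "dyadic L n' x \<subseteq> cbox a (\<chi> i. a $ i + L / 2 ^ n')"
      by (rule dyadic_sandwich[OF L(1)])
    \<comment> \<open>The closed cube around the parent \<open>R\<close> has the same side
      \<open>l\<close>, so passing to it costs no constant.\<close>
    define C where "C = cbox a (\<chi> i. a $ i + l)"
    have RC: "R \<subseteq> C" unfolding C_def R_def l_def by (rule a)
    \<comment> \<open>The double integral is restricted to \<open>x \<in> R - E\<close> and
      \<open>z \<in> E2 \<inter> Q\<close>, where the integrand is at least
      \<open>t\<close>.\<close>
    have "ennreal t * emeasure lebesgue (E2 \<inter> Q) * emeasure lebesgue (R - E)
        = (\<integral>\<^sup>+x. ennreal t * emeasure lebesgue (E2 \<inter> Q) * indicator (R - E) x \<partial>lebesgue)"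
      by (simp add: nn_integral_cmult_indicator)
    also have "\<dots> \<le> (\<integral>\<^sup>+x\<in>C. (\<integral>\<^sup>+z\<in>C. ennreal \<bar>f z - f x\<bar> \<partial>lebesgue) \<partial>lebesgue)"
    proof (intro nn_integral_mono)
      fix x
      show "ennreal t * emeasure lebesgue (E2 \<inter> Q) * indicator (R - E) x
          \<le> (\<integral>\<^sup>+z\<in>C. ennreal \<bar>f z - f x\<bar> \<partial>lebesgue) * indicator C x"
      proof (cases "x \<in> R - E")
        case True
        then have fx: "\<bar>f x\<bar> \<le> t" by (auto simp: E_def)
        have "ennreal t * emeasure lebesgue (E2 \<inter> Q) = (\<integral>\<^sup>+z. ennreal t * indicator (E2 \<inter> Q) z \<partial>lebesgue)"
          by (simp add: nn_integral_cmult_indicator)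
        also have "\<dots> \<le> (\<integral>\<^sup>+z\<in>C. ennreal \<bar>f z - f x\<bar> \<partial>lebesgue)"
        proof (intro nn_integral_mono)
          fix z
          show "ennreal t * indicator (E2 \<inter> Q) z \<le> ennreal \<bar>f z - f x\<bar> * indicator C z"
            using fx QR RC by (auto simp: E2_def split: split_indicator intro!: ennreal_leI)
        qed
        finally show ?thesis using True RC by (auto split: split_indicator)
      qed simp
    qed
    also have "\<dots> \<le> BMO_norm f * ennreal (w\<^sup>2)"
      unfolding C_def w_def by (rule BMO_norm_cube[OF l])
    finally have key: "ennreal t * emeasure lebesgue (E2 \<inter> Q) * emeasure lebesgue (R - E)
        \<le> BMO_norm f * ennreal (w\<^sup>2)" .
    have "emeasure lebesgue (E \<inter> R) \<le> ennreal w" "emeasure lebesgue (R - E) \<le> ennreal w"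
      unfolding R_eq[symmetric] by (auto intro!: emeasure_mono)
    then obtain b c where b: "emeasure lebesgue (E \<inter> R) = ennreal b" "0 \<le> b"
      and c: "emeasure lebesgue (R - E) = ennreal c" "0 \<le> c"
      by (meson ennreal_le_ennrealE)
    have "ennreal b + ennreal c = ennreal w"
      unfolding b(1)[symmetric] c(1)[symmetric] R_eq[symmetric]
      by (subst plus_emeasure) (auto intro!: arg_cong[where f = "emeasure lebesgue"])
    then have bc: "b + c = w"
      using b c w by (simp add: ennreal_plus[symmetric] del: ennreal_plus)
    have "2 * ennreal b \<le> ennreal w"
      using \<open>\<not> P R\<close> by (simp add: P_def R_eq b not_less)
    then have "2 * b \<le> w"
      using b w by (simp add: ennreal_mult[symmetric] flip: ennreal_numeral)
    with bc have c2: "w \<le> 2 * c" by simp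
    have "emeasure lebesgue (E \<inter> Q) \<le> ennreal (w / 2 ^ CARD('n))"
      "emeasure lebesgue (E2 \<inter> Q) \<le> ennreal (w / 2 ^ CARD('n))"
      unfolding Q_eq[symmetric] by (auto intro!: emeasure_mono)
    then obtain d e where d: "emeasure lebesgue (E \<inter> Q) = ennreal d" "0 \<le> d"
      and e: "emeasure lebesgue (E2 \<inter> Q) = ennreal e" "0 \<le> e"
      by (meson ennreal_le_ennrealE)
    have "ennreal (w / 2 ^ CARD('n)) < 2 * ennreal d"
      using Q(2) by (simp add: P_def Q_eq d)
    then have dw: "w < 2 * 2 ^ CARD('n) * d"
      using d w by (simp add: ennreal_mult[symmetric] ennreal_less_iff field_simps flip: ennreal_numeral)
    \<comment> \<open>Positivity of \<open>d\<close> makes the right-hand side infinite whenever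
      \<open>BMO_norm f\<close> is, despite \<open>0 * \<infinity> = 0\<close>.\<close>
    then have "0 < d" using w d by (cases "d = 0") auto
    show "ennreal t * emeasure lebesgue (E2 \<inter> Q)
      \<le> (ennreal (2 ^ (CARD('n) + 2)) * BMO_norm f) * emeasure lebesgue (E \<inter> Q)"
    proof (cases "BMO_norm f")
      case (real B)
      \<comment> \<open>At least half of the parent lies outside \<open>E\<close>, so
        \<open>w \<le> 2 * c\<close>; more than half of the child lies in \<open>E\<close>, so
        \<open>w < 2 * 2 ^ CARD('n) * d\<close>. The three factors 2, 2 and
        \<open>2 ^ CARD('n)\<close> make up the constant.\<close>
      have "ennreal (t * e * c) \<le> ennreal (B * w\<^sup>2)"
        using key real t c e by (simp add: ennreal_mult)
      then have "t * e * c \<le> B * w\<^sup>2"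
        using real by (simp add: ennreal_le_iff)
      moreover have "t * e * w \<le> t * e * (2 * c)"
        using c2 t e by (intro mult_left_mono) auto
      ultimately have "(t * e) * w \<le> (2 * B * w) * w"
        by (simp add: power2_eq_square)
      then have "t * e \<le> 2 * B * w" using w by simp
      also have "\<dots> \<le> 2 * B * (2 * 2 ^ CARD('n) * d)"
        using real dw by (intro mult_left_mono) auto
      finally have "t * e \<le> 2 ^ (CARD('n) + 2) * B * d" by (simp add: mult_ac)
      then show ?thesis
        using t real d e by (simp add: ennreal_mult[symmetric] ennreal_leI)
    next
      case top
      then show ?thesis
        using \<open>0 < d\<close> d by (simp add: ennreal_mult_top ennreal_top_mult)
    qed
  qed auto
  also have "\<dots> \<le> ennreal (2 ^ (CARD('n) + 2)) * BMO_norm f * emeasure lebesgue E"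
    by (intro mult_left_mono emeasure_mono) auto
  finally show ?thesis
    unfolding E2[symmetric] by (simp add: E_def E2_def)
qed

section \<open>The BMO seminorm under translations and differences\<close>

lemma borel_measurable_oscillation:
  fixes g :: "'a::euclidean_space \<Rightarrow> real"
  assumes [measurable]: "g \<in> borel_measurable lebesgue" "C \<in> sets lebesgue"
  shows "(\<lambda>x. \<integral>\<^sup>+z\<in>C. ennreal \<bar>g z - g x\<bar> \<partial>lebesgue) \<in> borel_measurable lebesgue"
proof -
  interpret sigma_finite_measure "lebesgue :: 'a measure" by (rule sigma_finite_lebesgue)
  show ?thesis by measurable
qed

lemma BMO_norm_diff:
  fixes g h :: "real ^ 'n \<Rightarrow> real"
  assumes [measurable]: "g \<in> borel_measurable lebesgue" "h \<in> borel_measurable lebesgue"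
  shows "BMO_norm (\<lambda>x. g x - h x) \<le> BMO_norm g + BMO_norm h"
proof -
  let ?V = "\<lambda>C. (emeasure lebesgue C)\<^sup>2"
  let ?I = "\<lambda>g C. (\<integral>\<^sup>+x\<in>C. (\<integral>\<^sup>+z\<in>C. ennreal \<bar>g z - g x\<bar> \<partial>lebesgue) \<partial>lebesgue)"
  have "?I (\<lambda>x. g x - h x) C / ?V C \<le> BMO_norm g + BMO_norm h"
    if C: "C \<in> cubes" for C
  proof -
    have [measurable]: "C \<in> sets lebesgue" using C by (auto simp: cubes_def)
    note [measurable] = borel_measurable_oscillation
    have "?I (\<lambda>x. g x - h x) C
      \<le> (\<integral>\<^sup>+x. (\<integral>\<^sup>+z. ennreal \<bar>g z - g x\<bar> * indicator C z + ennreal \<bar>h z - h x\<bar> * indicator C z \<partial>lebesgue)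
          * indicator C x \<partial>lebesgue)"
    proof (intro nn_integral_mono mult_right_mono)
      fix x z
      show "ennreal \<bar>g z - h z - (g x - h x)\<bar> * indicator C z
          \<le> ennreal \<bar>g z - g x\<bar> * indicator C z + ennreal \<bar>h z - h x\<bar> * indicator C z"
        by (auto split: split_indicator simp: ennreal_plus[symmetric] intro!: ennreal_leI simp del: ennreal_plus)
    qed auto
    also have "\<dots> = (\<integral>\<^sup>+x. (\<integral>\<^sup>+z\<in>C. ennreal \<bar>g z - g x\<bar> \<partial>lebesgue) * indicator C x
          + (\<integral>\<^sup>+z\<in>C. ennreal \<bar>h z - h x\<bar> \<partial>lebesgue) * indicator C x \<partial>lebesgue)"
      by (simp add: nn_integral_add distrib_right)
    also have "\<dots> = ?I g C + ?I h C"
      by (rule nn_integral_add) measurable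
    finally have "?I (\<lambda>x. g x - h x) C / ?V C \<le> (?I g C + ?I h C) / ?V C"
      by (rule divide_right_mono_ennreal)
    also have "\<dots> = ?I g C / ?V C + ?I h C / ?V C"
      by (rule add_divide_distrib_ennreal)
    also have "\<dots> \<le> BMO_norm g + BMO_norm h"
      unfolding BMO_norm_def by (intro add_mono SUP_upper C)
    finally show ?thesis .
  qed
  then show ?thesis
    unfolding BMO_norm_def[of "\<lambda>x. g x - h x"] by (intro SUP_least)
qed

text \<open>A cube shifted by \<open>c\<close> is a cube of the same measure, so both iterated
  integrals can be translated.\<close>

lemma BMO_norm_translation:
  fixes g :: "real ^ 'n \<Rightarrow> real"
  assumes [measurable]: "g \<in> borel_measurable lebesgue"
  shows "BMO_norm (\<lambda>x. g (x + c)) \<le> BMO_norm g"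
proof -
  let ?V = "\<lambda>C. (emeasure lebesgue C)\<^sup>2"
  let ?I = "\<lambda>g C. (\<integral>\<^sup>+x\<in>C. (\<integral>\<^sup>+z\<in>C. ennreal \<bar>g z - g x\<bar> \<partial>lebesgue) \<partial>lebesgue)"
  have "?I (\<lambda>x. g (x + c)) C / ?V C \<le> BMO_norm g" if C: "C \<in> cubes" for C
  proof -
    obtain a l where al: "C = cbox a (\<chi> i. a $ i + l)" "0 < l"
      using C by (auto simp: cubes_def)
    define C' where "C' = cbox (a + c) (\<chi> i. (a + c) $ i + l)"
    have C': "C' \<in> cubes" unfolding cubes_def C'_def using al(2) by blast
    have [measurable]: "C' \<in> sets lebesgue" by (simp add: C'_def)
    note [measurable] = borel_measurable_oscillation
    have mem: "indicator C x = (indicator C' (x + c) :: ennreal)" for x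
      by (auto simp: al C'_def mem_box_cart split: split_indicator)
    have V: "?V C = ?V C'"
      unfolding al(1) C'_def emeasure_lebesgue_cube(1)[OF less_imp_le[OF al(2)]] ..
    have "?I (\<lambda>x. g (x + c)) C = (\<integral>\<^sup>+x. (\<integral>\<^sup>+z\<in>C'. ennreal \<bar>g z - g (x + c)\<bar> \<partial>lebesgue) * indicator C' (x + c) \<partial>lebesgue)"
    proof (intro nn_integral_cong)
      fix x
      show "(\<integral>\<^sup>+z\<in>C. ennreal \<bar>g (z + c) - g (x + c)\<bar> \<partial>lebesgue) * indicator C x
        = (\<integral>\<^sup>+z\<in>C'. ennreal \<bar>g z - g (x + c)\<bar> \<partial>lebesgue) * indicator C' (x + c)"
        unfolding mem
        by (subst nn_integral_lebesgue_translation[of "\<lambda>z. ennreal \<bar>g z - g (x + c)\<bar> * indicator C' z" c]) simp_all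
    qed
    also have "\<dots> = ?I g C'"
      by (rule nn_integral_lebesgue_translation[of "\<lambda>x. (\<integral>\<^sup>+z\<in>C'. ennreal \<bar>g z - g x\<bar> \<partial>lebesgue) * indicator C' x" c])
        measurable
    finally have "?I (\<lambda>x. g (x + c)) C / ?V C = ?I g C' / ?V C'"
      unfolding V by simp
    also have "\<dots> \<le> BMO_norm g"
      unfolding BMO_norm_def by (rule SUP_upper[OF C'])
    finally show ?thesis .
  qed
  then show ?thesis
    unfolding BMO_norm_def[of "\<lambda>x. g (x + c)"] by (intro SUP_least)
qed

text \<open>Each order is a translate minus the function itself and at most doubles the
  seminorm.\<close>

lemma BMO_norm_fwd_diff:
  fixes f :: "real ^ 'n \<Rightarrow> real"
  assumes [measurable]: "f \<in> borel_measurable lebesgue"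
  shows "BMO_norm (fwd_diff k h f) \<le> 2 ^ k * BMO_norm f"
proof (induction k)
  case 0
  show ?case by simp
next
  case (Suc k)
  let ?g = "fwd_diff k h f"
  have [measurable]: "(\<lambda>x. ?g (x + h)) \<in> borel_measurable lebesgue"
    by measurable
  have "BMO_norm (fwd_diff (Suc k) h f) = BMO_norm (\<lambda>x. ?g (x + h) - ?g x)"
    by (simp add: fwd_diff_Suc[abs_def])
  also have "\<dots> \<le> BMO_norm (\<lambda>x. ?g (x + h)) + BMO_norm ?g"
    by (rule BMO_norm_diff) measurable
  also have "\<dots> \<le> BMO_norm ?g + BMO_norm ?g"
    by (intro add_mono BMO_norm_translation) auto
  also have "\<dots> \<le> 2 * (2 ^ k * BMO_norm f)"
    using Suc by (simp add: mult_2[symmetric] mult_left_mono)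
  finally show ?case by (simp add: mult_ac)
qed

section \<open>Weak quasi-norms and dyadic layers\<close>

definition weak_sup :: "real \<Rightarrow> (real ^ 'n \<Rightarrow> real) \<Rightarrow> ennreal" where
  "weak_sup r f = (SUP t\<in>{0<..}. ennreal t * emeasure lebesgue {x. \<bar>f x\<bar> powr r > t})"

lemma weak_Lp_norm_eq: "weak_Lp_norm r f = ennpowr (weak_sup r f) (1 / r)"
  by (simp add: weak_Lp_norm_def weak_sup_def)

text \<open>The supremum in \<open>weak_sup\<close> is tested at \<open>t powr r\<close>.\<close>

lemma emeasure_superlevel_le:
  assumes "0 < r" "weak_sup r f = ennreal W" "0 \<le> W" "0 < t"
  shows "emeasure lebesgue {x. \<bar>f x\<bar> > t} \<le> ennreal (W * t powr - r)"
proof -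
  have "t < \<bar>f x\<bar> \<longleftrightarrow> t powr r < \<bar>f x\<bar> powr r" for x
    using assms powr_less_mono2[of r t "\<bar>f x\<bar>"] powr_mono2[of r "\<bar>f x\<bar>" t] by linarith
  then have "{x. \<bar>f x\<bar> > t} = {x. \<bar>f x\<bar> powr r > t powr r}"
    by simp
  moreover have "ennreal (t powr r) * emeasure lebesgue {x. \<bar>f x\<bar> powr r > t powr r} \<le> ennreal W"
    unfolding assms(2)[symmetric] weak_sup_def
    using assms by (intro SUP_upper2[of "t powr r"]) auto
  ultimately have le: "ennreal (t powr r) * emeasure lebesgue {x. \<bar>f x\<bar> > t} \<le> ennreal W" by simp
  have "emeasure lebesgue {x. \<bar>f x\<bar> > t}
      = ennreal (t powr - r) * (ennreal (t powr r) * emeasure lebesgue {x. \<bar>f x\<bar> > t})"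
    using assms by (simp add: mult.assoc[symmetric] ennreal_mult[symmetric] powr_add[symmetric])
  also have "\<dots> \<le> ennreal (t powr - r) * ennreal W"
    by (intro mult_left_mono le) auto
  finally show ?thesis
    using assms by (simp add: ennreal_mult[symmetric] mult.commute)
qed

text \<open>A single term suffices: for \<open>a > \<tau>\<close> the layer with
  \<open>2 ^ i * \<tau> < a \<le> 2 ^ Suc i * \<tau>\<close>, for \<open>0 < a \<le> \<tau>\<close>
  the one with \<open>\<tau> / 2 ^ Suc i < a \<le> \<tau> / 2 ^ i\<close>. The series stay separate
  because superlevel sets above and below \<open>\<tau>\<close> are estimated differently.\<close>

lemma powr_le_dyadic_layers:
  fixes a \<tau> p :: real
  assumes "0 \<le> a" "0 < \<tau>" "0 < p"
  shows "ennreal (a powr p)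
    \<le> (\<Sum>i. ennreal ((2 ^ Suc i * \<tau>) powr p) * indicator {2 ^ i * \<tau><..} a)
      + (\<Sum>i. ennreal ((\<tau> / 2 ^ i) powr p) * indicator {\<tau> / 2 ^ Suc i<..} a)"
proof -
  have le_suminf: "g i \<le> (\<Sum>i. g i)" for g :: "nat \<Rightarrow> ennreal" and i
    using sum_le_suminf[OF summableI, of "{i}" g] by simp
  consider "a = 0" | "\<tau> < a" | "0 < a" "a \<le> \<tau>" using assms by linarith
  then show ?thesis
  proof cases
    case 2
    obtain n where "a / \<tau> < 2 ^ n" using real_arch_pow[of 2 "a / \<tau>"] by auto
    then have ex: "\<exists>n. a \<le> 2 ^ n * \<tau>" using assms by (auto simp: field_simps intro: less_imp_le)
    define n where "n = (LEAST n. a \<le> 2 ^ n * \<tau>)"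
    have n: "a \<le> 2 ^ n * \<tau>" unfolding n_def using ex by (rule LeastI_ex)
    then obtain i where i: "n = Suc i" using 2 by (cases n) auto
    then have "\<not> a \<le> 2 ^ i * \<tau>" using not_less_Least[of i "\<lambda>n. a \<le> 2 ^ n * \<tau>"] by (simp add: n_def)
    then have "ennreal (a powr p) \<le> ennreal ((2 ^ Suc i * \<tau>) powr p) * indicator {2 ^ i * \<tau><..} a"
      using n i assms by (auto intro!: ennreal_leI powr_mono2)
    also have "\<dots> \<le> (\<Sum>i. ennreal ((2 ^ Suc i * \<tau>) powr p) * indicator {2 ^ i * \<tau><..} a)"
      by (rule le_suminf)
    finally show ?thesis by (rule order.trans) simp
  next
    case 3
    obtain n where "\<tau> / a < 2 ^ n" using real_arch_pow[of 2 "\<tau> / a"] by auto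
    then have "\<tau> / 2 ^ n < a" using 3 by (auto simp: field_simps)
    then have ex: "\<exists>n. \<tau> / 2 ^ n < a" by blast
    define n where "n = (LEAST n. \<tau> / 2 ^ n < a)"
    have n: "\<tau> / 2 ^ n < a" unfolding n_def using ex by (rule LeastI_ex)
    then obtain i where i: "n = Suc i" using 3 by (cases n) auto
    then have "\<not> \<tau> / 2 ^ i < a" using not_less_Least[of i "\<lambda>n. \<tau> / 2 ^ n < a"] by (simp add: n_def)
    then have "ennreal (a powr p) \<le> ennreal ((\<tau> / 2 ^ i) powr p) * indicator {\<tau> / 2 ^ Suc i<..} a"
      using n assms unfolding i by (auto intro!: ennreal_leI powr_mono2)
    also have "\<dots> \<le> (\<Sum>i. ennreal ((\<tau> / 2 ^ i) powr p) * indicator {\<tau> / 2 ^ Suc i<..} a)"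
      by (rule le_suminf)
    finally show ?thesis by (rule order.trans) simp
  qed simp
qed

lemma power_integral_le_layers:
  fixes f :: "real ^ 'n \<Rightarrow> real"
  assumes [measurable]: "f \<in> borel_measurable lebesgue" and "0 < \<tau>" "0 < p"
  shows "power_integral p f
    \<le> (\<Sum>i. ennreal ((2 ^ Suc i * \<tau>) powr p) * emeasure lebesgue {x. \<bar>f x\<bar> > 2 ^ i * \<tau>})
      + (\<Sum>i. ennreal ((\<tau> / 2 ^ i) powr p) * emeasure lebesgue {x. \<bar>f x\<bar> > \<tau> / 2 ^ Suc i})"
proof -
  have m [measurable]: "(\<lambda>x. indicator {c<..} \<bar>f x\<bar> :: ennreal) \<in> borel_measurable lebesgue" for c
    by measurable
  have em: "(\<integral>\<^sup>+x. indicator {c<..} \<bar>f x\<bar> \<partial>lebesgue) = emeasure lebesgue {x. \<bar>f x\<bar> > c}" for c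
  proof -
    have "{x \<in> space lebesgue. \<bar>f x\<bar> > c} \<in> sets lebesgue" by measurable
    moreover have "indicator {c<..} \<bar>f x\<bar> = (indicator {x. \<bar>f x\<bar> > c} x :: ennreal)" for x
      by (auto split: split_indicator)
    ultimately show ?thesis by simp
  qed
  have "power_integral p f \<le> (\<integral>\<^sup>+x. (\<Sum>i. ennreal ((2 ^ Suc i * \<tau>) powr p) * indicator {2 ^ i * \<tau><..} \<bar>f x\<bar>)
      + (\<Sum>i. ennreal ((\<tau> / 2 ^ i) powr p) * indicator {\<tau> / 2 ^ Suc i<..} \<bar>f x\<bar>) \<partial>lebesgue)"
    unfolding power_integral_def
    by (intro nn_integral_mono powr_le_dyadic_layers) (use assms in auto)
  also have "\<dots> = (\<Sum>i. \<integral>\<^sup>+x. ennreal ((2 ^ Suc i * \<tau>) powr p) * indicator {2 ^ i * \<tau><..} \<bar>f x\<bar> \<partial>lebesgue)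
      + (\<Sum>i. \<integral>\<^sup>+x. ennreal ((\<tau> / 2 ^ i) powr p) * indicator {\<tau> / 2 ^ Suc i<..} \<bar>f x\<bar> \<partial>lebesgue)"
    by (subst nn_integral_add; (subst nn_integral_suminf)?; (subst nn_integral_suminf)?) measurable
  also have "\<dots> = (\<Sum>i. ennreal ((2 ^ Suc i * \<tau>) powr p) * emeasure lebesgue {x. \<bar>f x\<bar> > 2 ^ i * \<tau>})
      + (\<Sum>i. ennreal ((\<tau> / 2 ^ i) powr p) * emeasure lebesgue {x. \<bar>f x\<bar> > \<tau> / 2 ^ Suc i})"
    unfolding em[symmetric] by (subst (1 2) nn_integral_cmult) measurable
  finally show ?thesis .
qed

lemma suminf_geometric_le:
  assumes "0 \<le> c" "0 \<le> \<theta>" "\<theta> < 1" "\<And>i. g i \<le> ennreal (c * \<theta> ^ i)"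
  shows "(\<Sum>i. g i) \<le> ennreal (c / (1 - \<theta>))"
proof -
  have "(\<lambda>i. c * \<theta> ^ i) sums (c * (1 / (1 - \<theta>)))"
    using assms by (intro sums_mult geometric_sums) auto
  then have "(\<Sum>i. ennreal (c * \<theta> ^ i)) = ennreal (c / (1 - \<theta>))"
    using assms by (intro suminf_ennreal_eq) auto
  moreover have "(\<Sum>i. g i) \<le> (\<Sum>i. ennreal (c * \<theta> ^ i))"
    by (intro suminf_le assms summableI)
  ultimately show ?thesis by simp
qed

text \<open>Above the level \<^term>\<open>\<tau>\<close> each doubling of the level costs a factor \<open>2 powr - (p + 1)\<close> in measure.\<close>
lemma power_integral_le_of_level:
  fixes f :: "real ^ 'n \<Rightarrow> real"
  assumes f [measurable]: "f \<in> borel_measurable lebesgue" and r: "0 < r" "r < p"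
    and W: "weak_sup r f = ennreal W" "0 \<le> W" and B: "BMO_norm f = ennreal B" "0 \<le> B"
    and \<tau>: "0 < \<tau>" "2 powr (p + 1) * 2 ^ (CARD('n) + 2) * B \<le> \<tau>"
  shows "power_integral p f
    \<le> ennreal ((2 * 2 powr p + 2 powr r / (1 - 2 powr (r - p))) * \<tau> powr (p - r) * W)"
proof -
  let ?\<mu> = "\<lambda>t. emeasure lebesgue {x. \<bar>f x\<bar> > t}"
  let ?D = "2 ^ (CARD('n) + 2) :: real"
  have p: "0 < p" using r by simp
  note level = emeasure_superlevel_le[OF r(1) W]
  \<comment> \<open>The induction starts from the weak bound at \<open>\<tau>\<close> and applies
    the doubling inequality at the levels \<open>2 ^ i * \<tau>\<close>; the weak bound also
    supplies the finite measure which that inequality requires.\<close>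
  have iter: "?\<mu> (2 ^ i * \<tau>) \<le> ennreal ((2 powr - (p + 1)) ^ i * (W * \<tau> powr - r))" for i
  proof (induction i)
    case 0
    show ?case using level[OF \<tau>(1)] by simp
  next
    case (Suc i)
    have pos: "0 < 2 ^ i * \<tau>" using \<tau> by simp
    have fin: "?\<mu> (2 ^ i * \<tau>) < top"
      using level[OF pos] by (rule order.strict_trans1) simp
    from Suc obtain m where m: "?\<mu> (2 ^ i * \<tau>) = ennreal m" "0 \<le> m"
      by (rule ennreal_le_ennrealE)
    have dbl: "ennreal (2 ^ i * \<tau>) * ?\<mu> (2 * (2 ^ i * \<tau>)) \<le> ennreal (?D * B * m)"
      using BMO_distribution_doubling[OF f pos fin] m B by (simp add: ennreal_mult)
    have "0 < 2 * (2 ^ i * \<tau>)" using pos by simp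
    from level[OF this] obtain m' where m': "?\<mu> (2 * (2 ^ i * \<tau>)) = ennreal m'" "0 \<le> m'"
      by (rule ennreal_le_ennrealE)
    have le: "2 ^ i * \<tau> * m' \<le> ?D * B * m"
      using dbl m m' B pos \<tau> by (simp add: ennreal_mult[symmetric] ennreal_le_iff)
    \<comment> \<open>The extra gain \<open>2 ^ i\<close> is discarded; the lower bound on
      \<open>\<tau>\<close> turns the doubling constant into
      \<open>2 powr - (p + 1)\<close>.\<close>
    have "1 * (\<tau> * m') \<le> 2 ^ i * (\<tau> * m')"
      using \<tau> m' by (intro mult_right_mono) auto
    also have "\<dots> \<le> ?D * B * m" using le by (simp add: mult.assoc)
    also have "\<dots> = 2 powr - (p + 1) * (2 powr (p + 1) * ?D * B) * m"
      by (simp add: mult.assoc[symmetric] powr_add[symmetric])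
    also have "\<dots> \<le> 2 powr - (p + 1) * \<tau> * m"
      using \<tau> m by (intro mult_right_mono mult_left_mono) auto
    finally have "\<tau> * m' \<le> \<tau> * (2 powr - (p + 1) * m)" by (simp only: mult_1 mult_ac)
    then have "m' \<le> 2 powr - (p + 1) * m" using \<tau> by simp
    also have "\<dots> \<le> 2 powr - (p + 1) * ((2 powr - (p + 1)) ^ i * (W * \<tau> powr - r))"
      using Suc m W by (intro mult_left_mono) (auto simp: ennreal_le_iff)
    finally show ?case
      using m' by (simp add: mult_ac ennreal_leI)
  qed
  \<comment> \<open>From one layer to the next the power of the level grows by
    \<open>2 powr p\<close> and the measure bound shrinks by \<open>2 powr - (p + 1)\<close>, which
    leaves the ratio \<open>1 / 2\<close>.\<close>
  have "(\<Sum>i. ennreal ((2 ^ Suc i * \<tau>) powr p) * ?\<mu> (2 ^ i * \<tau>))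
      \<le> ennreal ((2 powr p * \<tau> powr (p - r) * W) / (1 - 1 / 2))"
  proof (rule suminf_geometric_le)
    fix i
    have "ennreal ((2 ^ Suc i * \<tau>) powr p) * ?\<mu> (2 ^ i * \<tau>)
        \<le> ennreal ((2 ^ Suc i * \<tau>) powr p) * ennreal ((2 powr - (p + 1)) ^ i * (W * \<tau> powr - r))"
      by (intro mult_left_mono iter) auto
    also have "\<dots> = ennreal ((2 ^ Suc i * \<tau>) powr p * ((2 powr - (p + 1)) ^ i * (W * \<tau> powr - r)))"
      using W by (simp add: ennreal_mult)
    also have "(2 ^ Suc i * \<tau>) powr p * ((2 powr - (p + 1)) ^ i * (W * \<tau> powr - r))
        = (2 powr p * \<tau> powr (p - r) * W) * (1 / 2) ^ i"
    proof -
      have "(2 ^ Suc i * \<tau>) powr p = 2 powr p * (2 powr p) ^ i * \<tau> powr p"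
        using \<tau> by (simp add: powr_mult powr_powr powr_realpow[symmetric] mult.commute)
      moreover have "(2 powr p) ^ i * (2 powr - (p + 1)) ^ i = (1 / 2) ^ i"
        unfolding power_mult_distrib[symmetric] powr_add[symmetric] by (simp add: powr_minus_divide)
      moreover have "\<tau> powr (p - r) = \<tau> powr p * \<tau> powr - r"
        by (simp add: powr_add[symmetric])
      ultimately show ?thesis by (simp add: mult_ac)
    qed
    finally show "ennreal ((2 ^ Suc i * \<tau>) powr p) * ?\<mu> (2 ^ i * \<tau>)
      \<le> ennreal ((2 powr p * \<tau> powr (p - r) * W) * (1 / 2) ^ i)" .
  qed (use W in auto)
  \<comment> \<open>Below \<open>\<tau>\<close> the weak bound alone gives the ratio
    \<open>2 powr (r - p)\<close>, which is less than 1 because \<open>r < p\<close>.\<close>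
  moreover have "(\<Sum>i. ennreal ((\<tau> / 2 ^ i) powr p) * ?\<mu> (\<tau> / 2 ^ Suc i))
      \<le> ennreal ((2 powr r * \<tau> powr (p - r) * W) / (1 - 2 powr (r - p)))"
  proof (rule suminf_geometric_le)
    fix i
    have "ennreal ((\<tau> / 2 ^ i) powr p) * ?\<mu> (\<tau> / 2 ^ Suc i)
        \<le> ennreal ((\<tau> / 2 ^ i) powr p) * ennreal (W * (\<tau> / 2 ^ Suc i) powr - r)"
      using \<tau> by (intro mult_left_mono level) auto
    also have "\<dots> = ennreal ((\<tau> / 2 ^ i) powr p * (W * (\<tau> / 2 ^ Suc i) powr - r))"
      using W by (simp add: ennreal_mult)
    also have "(\<tau> / 2 ^ i) powr p * (W * (\<tau> / 2 ^ Suc i) powr - r)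
        = (2 powr r * \<tau> powr (p - r) * W) * (2 powr (r - p)) ^ i"
    proof -
      have "(\<tau> / 2 ^ i) powr p = \<tau> powr p * (2 powr - p) ^ i"
        using \<tau> by (simp add: powr_divide powr_powr powr_realpow[symmetric] powr_minus_divide mult.commute)
      moreover have "(\<tau> / 2 ^ Suc i) powr - r = \<tau> powr - r * (2 powr r * (2 powr r) ^ i)"
        using \<tau> by (simp add: powr_divide powr_mult powr_powr powr_realpow[symmetric] powr_minus_divide mult.commute)
      moreover have "(2 powr (r - p)) ^ i = (2 powr - p) ^ i * (2 powr r) ^ i"
        unfolding power_mult_distrib[symmetric] powr_add[symmetric] by simp
      moreover have "\<tau> powr (p - r) = \<tau> powr p * \<tau> powr - r"
        by (simp add: powr_add[symmetric])
      ultimately show ?thesis by (simp add: mult_ac)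
    qed
    finally show "ennreal ((\<tau> / 2 ^ i) powr p) * ?\<mu> (\<tau> / 2 ^ Suc i)
      \<le> ennreal ((2 powr r * \<tau> powr (p - r) * W) * (2 powr (r - p)) ^ i)" .
  qed (use W r in \<open>auto simp: powr_less_one\<close>)
  ultimately have "power_integral p f
    \<le> ennreal ((2 powr p * \<tau> powr (p - r) * W) / (1 - 1 / 2))
      + ennreal ((2 powr r * \<tau> powr (p - r) * W) / (1 - 2 powr (r - p)))"
    by (intro order.trans[OF power_integral_le_layers[OF f \<tau>(1) p]] add_mono)
  also have "\<dots> = ennreal ((2 powr p * \<tau> powr (p - r) * W) / (1 - 1 / 2)
      + (2 powr r * \<tau> powr (p - r) * W) / (1 - 2 powr (r - p)))"
    using W r by (intro ennreal_plus[symmetric]) (auto simp: powr_less_one less_imp_le)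
  also have "(2 powr p * \<tau> powr (p - r) * W) / (1 - 1 / 2)
      + (2 powr r * \<tau> powr (p - r) * W) / (1 - 2 powr (r - p))
    = (2 * 2 powr p + 2 powr r / (1 - 2 powr (r - p))) * \<tau> powr (p - r) * W"
    by (simp add: algebra_simps)
  finally show ?thesis .
qed

text \<open>A level \<open>\<tau>\<close> proportional to the BMO seminorm turns
  \<open>\<tau> powr (p - r)\<close> into the required factor.\<close>

lemma power_integral_interpolation:
  fixes p r :: real
  assumes r: "0 < r" "r < p"
  obtains C where "0 < C"
    "\<And>f :: real ^ 'n \<Rightarrow> real. f \<in> borel_measurable lebesgue \<Longrightarrow> BMO_norm f < top \<Longrightarrow> weak_sup r f < top \<Longrightarrow>
      power_integral p f \<le> ennreal C * ennpowr (BMO_norm f) (p - r) * weak_sup r f"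
proof -
  define A where "A = 2 * 2 powr p + 2 powr r / (1 - 2 powr (r - p))"
  have A: "0 < A"
    using r unfolding A_def by (intro add_pos_pos divide_pos_pos) (auto simp: powr_less_one)
  define D where "D = 2 powr (p + 1) * 2 ^ (CARD('n) + 2)"
  have D: "0 < D" by (simp add: D_def)
  define C where "C = A * D powr (p - r)"
  have C: "0 < C" using A D by (simp add: C_def)
  have "power_integral p f \<le> ennreal C * ennpowr (BMO_norm f) (p - r) * weak_sup r f"
    if f: "f \<in> borel_measurable lebesgue" and fin: "BMO_norm f < top" "weak_sup r f < top"
    for f :: "real ^ 'n \<Rightarrow> real"
  proof -
    obtain B where B: "BMO_norm f = ennreal B" "0 \<le> B"
      using fin by (cases "BMO_norm f") auto
    obtain W where W: "weak_sup r f = ennreal W" "0 \<le> W"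
      using fin by (cases "weak_sup r f") auto
    have bound: "power_integral p f \<le> ennreal (A * \<tau> powr (p - r) * W)" if "0 < \<tau>" "D * B \<le> \<tau>" for \<tau>
      unfolding A_def using power_integral_le_of_level[OF f r W B] that by (simp add: D_def)
    show ?thesis
    proof (cases "B = 0")
      case True
      \<comment> \<open>For \<open>B = 0\<close> every positive level is admissible, and letting
        \<open>\<tau>\<close> tend to 0 forces the integral to vanish.\<close>
      have "((\<lambda>\<tau>. ennreal (A * \<tau> powr (p - r) * W)) \<longlongrightarrow> ennreal (A * 0 powr (p - r) * W)) (at_right 0)"
        using r by (intro tendsto_intros) (auto simp: eventually_at_right_less intro: eventually_mono[OF eventually_at_right_less])
      moreover have "\<forall>\<^sub>F \<tau> in at_right 0. power_integral p f \<le> ennreal (A * \<tau> powr (p - r) * W)"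
        using True by (auto intro!: eventually_mono[OF eventually_at_right_less[of 0]] bound)
      ultimately have "power_integral p f \<le> ennreal (A * 0 powr (p - r) * W)"
        by (intro tendsto_lowerbound) auto
      then show ?thesis by simp
    next
      case False
      then have "power_integral p f \<le> ennreal (A * (D * B) powr (p - r) * W)"
        using B D by (intro bound) auto
      also have "\<dots> = ennreal C * ennpowr (BMO_norm f) (p - r) * weak_sup r f"
        using A D B W by (simp add: C_def powr_mult ennpowr_ennreal ennreal_mult mult_ac)
      finally show ?thesis .
    qed
  qed
  with that C show ?thesis by blast
qed

lemma Lp_norm_interpolation:
  fixes p r :: real
  assumes r: "0 < r" "r < p"
  obtains C where "0 < C"
    "\<And>f :: real ^ 'n \<Rightarrow> real. f \<in> borel_measurable lebesgue \<Longrightarrow> BMO_norm f < top \<Longrightarrow> weak_Lp_norm r f < top \<Longrightarrow>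
      Lp_norm p f \<le> ennreal C * ennpowr (BMO_norm f) (1 - r / p) * ennpowr (weak_Lp_norm r f) (r / p)"
proof -
  obtain C where C: "0 < C"
    "\<And>f :: real ^ 'n \<Rightarrow> real. f \<in> borel_measurable lebesgue \<Longrightarrow> BMO_norm f < top \<Longrightarrow> weak_sup r f < top \<Longrightarrow>
      power_integral p f \<le> ennreal C * ennpowr (BMO_norm f) (p - r) * weak_sup r f"
    using power_integral_interpolation[OF r] by metis
  have "Lp_norm p f \<le> ennreal (C powr (1 / p)) * ennpowr (BMO_norm f) (1 - r / p) * ennpowr (weak_Lp_norm r f) (r / p)"
    if "f \<in> borel_measurable lebesgue" "BMO_norm f < top" "weak_Lp_norm r f < top" for f :: "real ^ 'n \<Rightarrow> real"
  proof -
    have exp: "(p - r) * (1 / p) = 1 - r / p" "1 / r * (r / p) = 1 / p"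
      using r by (auto simp: field_simps)
    have "Lp_norm p f \<le> ennpowr (ennreal C * ennpowr (BMO_norm f) (p - r) * weak_sup r f) (1 / p)"
      unfolding Lp_norm_eq using that r
      by (intro ennpowr_mono C(2)) (auto simp: weak_Lp_norm_eq)
    also have "\<dots> = ennreal (C powr (1 / p)) * ennpowr (BMO_norm f) (1 - r / p) * ennpowr (weak_Lp_norm r f) (r / p)"
      unfolding weak_Lp_norm_eq ennpowr_mult ennpowr_ennpowr exp using C(1) by (simp add: ennpowr_ennreal)
    finally show ?thesis .
  qed
  with that[of "C powr (1 / p)"] C(1) show ?thesis by simp
qed

section \<open>Interpolation of Besov norms\<close>

lemma modulus_interpolation:
  fixes p r :: real
  assumes r: "0 < r" "r < p"
  obtains C where "0 < C"
    "\<And>(u :: real ^ 'n \<Rightarrow> real) t. u \<in> borel_measurable lebesgue \<Longrightarrow> BMO_norm u < top \<Longrightarrow> weak_Lp_norm r u < top \<Longrightarrow>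
      modulus (Lp_norm p) K u t
        \<le> ennreal C * ennpowr (BMO_norm u) (1 - r / p) * ennpowr (modulus (weak_Lp_norm r) K u t) (r / p)"
proof -
  have p: "0 < p" and rp: "0 < r / p" "0 < 1 - r / p" using r by auto
  obtain C where C: "0 < C"
    "\<And>f :: real ^ 'n \<Rightarrow> real. f \<in> borel_measurable lebesgue \<Longrightarrow> BMO_norm f < top \<Longrightarrow> weak_Lp_norm r f < top \<Longrightarrow>
      Lp_norm p f \<le> ennreal C * ennpowr (BMO_norm f) (1 - r / p) * ennpowr (weak_Lp_norm r f) (r / p)"
    using Lp_norm_interpolation[OF r] by metis
  define D where "D = C * (2 ^ K) powr (1 - r / p)"
  have D: "0 < D" using C by (simp add: D_def)
  have "modulus (Lp_norm p) K u t
        \<le> ennreal D * ennpowr (BMO_norm u) (1 - r / p) * ennpowr (modulus (weak_Lp_norm r) K u t) (r / p)"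
    if u: "u \<in> borel_measurable lebesgue" and fin: "BMO_norm u < top" "weak_Lp_norm r u < top"
    for u :: "real ^ 'n \<Rightarrow> real" and t
    unfolding modulus_def
  proof (rule SUP_least)
    fix h :: "real ^ 'n" assume h: "h \<in> {h. norm h \<le> t}"
    let ?g = "fwd_diff K h u"
    have "Lp_norm p ?g \<le> ennreal D * ennpowr (BMO_norm u) (1 - r / p) * ennpowr (weak_Lp_norm r ?g) (r / p)"
    proof (cases "weak_Lp_norm r ?g = top")
      \<comment> \<open>The right-hand side is infinite unless the BMO seminorm is 0, where
        \<open>0 * \<infinity> = 0\<close> intervenes. In that case interpolation for
        \<open>u\<close> itself gives \<open>Lp_norm p u = 0\<close>, which the differences
        inherit.\<close>
      case True
      show ?thesis
      proof (cases "BMO_norm u = 0")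
        case True
        then have "Lp_norm p u = 0"
          using C(2)[OF u fin] by simp
        then have "Lp_norm p ?g \<le> 0"
          using modulus_Lp_le[OF u p, of K t] SUP_upper[OF h, of "\<lambda>h. Lp_norm p (fwd_diff K h u)"]
          by (simp add: modulus_def)
        then show ?thesis by simp
      next
        case False
        then have "ennpowr (BMO_norm u) (1 - r / p) \<noteq> 0"
          using fin by (cases "BMO_norm u") (auto simp: ennpowr_ennreal)
        then show ?thesis
          using True D by (simp add: ennreal_mult_top)
      qed
    next
      case False
      have B: "BMO_norm ?g \<le> 2 ^ K * BMO_norm u"
        by (rule BMO_norm_fwd_diff[OF u])
      moreover have "2 ^ K * BMO_norm u < top"
        using fin by (simp add: ennreal_mult_less_top power_less_top_ennreal)
      ultimately have "BMO_norm ?g < top" by simp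
      then have "Lp_norm p ?g \<le> ennreal C * ennpowr (BMO_norm ?g) (1 - r / p) * ennpowr (weak_Lp_norm r ?g) (r / p)"
        using False u by (intro C) (auto simp: less_top[symmetric])
      also have "\<dots> \<le> ennreal C * ennpowr (2 ^ K * BMO_norm u) (1 - r / p) * ennpowr (weak_Lp_norm r ?g) (r / p)"
        using rp by (intro mult_right_mono mult_left_mono ennpowr_mono B) auto
      also have "\<dots> = ennreal D * ennpowr (BMO_norm u) (1 - r / p) * ennpowr (weak_Lp_norm r ?g) (r / p)"
      proof -
        have "(2 ^ K :: ennreal) = ennreal (2 ^ K)"
          by (simp add: ennreal_power[symmetric])
        then have "ennpowr (2 ^ K) (1 - r / p) = ennreal ((2 ^ K) powr (1 - r / p))"
          by (simp only: ennpowr_ennreal zero_le_power zero_le_numeral)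
        then show ?thesis
          using C(1) by (simp add: ennpowr_mult D_def ennreal_mult mult_ac)
      qed
      finally show ?thesis .
    qed
    also have "\<dots> \<le> ennreal D * ennpowr (BMO_norm u) (1 - r / p)
        * ennpowr (SUP h\<in>{h. norm h \<le> t}. weak_Lp_norm r (fwd_diff K h u)) (r / p)"
      using rp by (intro mult_left_mono ennpowr_mono SUP_upper h) auto
    finally show "Lp_norm p ?g \<le> \<dots>" .
  qed
  with that D show ?thesis by blast
qed

text \<open>The power \<open>\<theta>\<close> turns the weight \<open>t powr s\<close> into
  \<open>t powr (s * \<theta>)\<close>, and a further power \<open>q\<close> acts as the power
  \<open>q * \<theta>\<close>. This accounts for the change of both parameters.\<close>

lemma besov_order_interpolation:
  fixes \<theta> s :: real and q c :: ennreal
  assumes \<theta>: "0 < \<theta>" and q: "0 < q"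
    and le: "\<And>t. 0 < t \<Longrightarrow> modulus M k f t \<le> c * ennpowr (modulus M' k f t) \<theta>"
  shows "besov_order M k (s * \<theta>) q f \<le> c * ennpowr (besov_order M' k s (q * ennreal \<theta>) f) \<theta>"
proof -
  have quot: "modulus M k f t / ennreal (t powr (s * \<theta>))
      \<le> c * ennpowr (modulus M' k f t / ennreal (t powr s)) \<theta>" if t: "0 < t" for t
  proof -
    have "modulus M k f t / ennreal (t powr (s * \<theta>))
        \<le> c * ennpowr (modulus M' k f t) \<theta> / ennreal (t powr (s * \<theta>))"
      by (intro divide_right_mono_ennreal le t)
    then show ?thesis
      using t by (simp add: ennpowr_divide powr_powr ennreal_times_divide)
  qed
  show ?thesis
  proof (cases "q = top")
    case True
    have "q * ennreal \<theta> = top" using True \<theta> by (simp add: ennreal_top_mult)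
    moreover have "(SUP t\<in>{0<..}. modulus M k f t / ennreal (t powr (s * \<theta>)))
      \<le> c * ennpowr (SUP t\<in>{0<..}. modulus M' k f t / ennreal (t powr s)) \<theta>"
      unfolding ennpowr_SUP[OF \<theta>] SUP_mult_left_ennreal
      by (intro SUP_mono) (use quot in auto)
    ultimately show ?thesis
      using True by (simp add: besov_order_def)
  next
    case False
    define q' where "q' = enn2real q"
    have q': "0 < q'"
      using q False by (simp add: q'_def enn2real_positive_iff less_top)
    have q\<theta>: "q * ennreal \<theta> \<noteq> top" "enn2real (q * ennreal \<theta>) = q' * \<theta>"
      using False \<theta> by (auto simp: q'_def enn2real_mult ennreal_mult_eq_top_iff)
    let ?G = "\<lambda>t. ennpowr (modulus M' k f t / ennreal (t powr s)) (q' * \<theta>) / ennreal t * indicator {0<..} t"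
    have "(\<integral>\<^sup>+t\<in>{0<..}. ennpowr (modulus M k f t / ennreal (t powr (s * \<theta>))) q' / ennreal t \<partial>lborel)
        \<le> (\<integral>\<^sup>+t. ennpowr c q' * ?G t \<partial>lborel)"
    proof (intro nn_integral_mono)
      fix t :: real
      show "ennpowr (modulus M k f t / ennreal (t powr (s * \<theta>))) q' / ennreal t * indicator {0<..} t
          \<le> ennpowr c q' * ?G t"
      proof (cases "0 < t")
        case True
        have "ennpowr (modulus M k f t / ennreal (t powr (s * \<theta>))) q'
            \<le> ennpowr (c * ennpowr (modulus M' k f t / ennreal (t powr s)) \<theta>) q'"
          using q' by (intro ennpowr_mono quot True) auto
        also have "\<dots> = ennpowr c q' * ennpowr (modulus M' k f t / ennreal (t powr s)) (q' * \<theta>)"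
          by (simp add: ennpowr_mult ennpowr_ennpowr mult.commute)
        finally show ?thesis
          using True by (simp add: divide_right_mono_ennreal ennreal_times_divide)
      qed simp
    qed
    also have "\<dots> = ennpowr c q' * (\<integral>\<^sup>+t. ?G t \<partial>lborel)"
      by (rule nn_integral_cmult) measurable
    finally have "ennpowr (\<integral>\<^sup>+t\<in>{0<..}. ennpowr (modulus M k f t / ennreal (t powr (s * \<theta>))) q' / ennreal t \<partial>lborel) (1 / q')
        \<le> ennpowr (ennpowr c q' * (\<integral>\<^sup>+t. ?G t \<partial>lborel)) (1 / q')"
      using q' by (intro ennpowr_mono) auto
    also have "\<dots> = c * ennpowr (ennpowr (\<integral>\<^sup>+t. ?G t \<partial>lborel) (1 / (q' * \<theta>))) \<theta>"
      using q' \<theta> by (simp add: ennpowr_mult ennpowr_ennpowr)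
    finally show ?thesis
      using False q\<theta> by (simp add: besov_order_def q'_def)
  qed
qed

lemma less_diff_order: "s < real (diff_order s)"
  unfolding diff_order_def by (rule LeastI_ex) (rule reals_Archimedean2)

lemma diff_order_mono: "s \<le> s' \<Longrightarrow> diff_order s \<le> diff_order s'"
  using less_diff_order[of s'] by (auto simp: diff_order_def[of s] intro: Least_le)

text \<open>Chebyshev's inequality for \<open>\<bar>f\<bar> powr r\<close>.\<close>

lemma weak_Lp_norm_le_Lp_norm:
  fixes f :: "real ^ 'n \<Rightarrow> real"
  assumes [measurable]: "f \<in> borel_measurable lebesgue" and "0 < r"
  shows "weak_Lp_norm r f \<le> Lp_norm r f"
  unfolding weak_Lp_norm_def Lp_norm_def
proof (intro ennpowr_mono SUP_least)
  fix t :: real assume t: "t \<in> {0<..}"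
  have "{x \<in> space lebesgue. \<bar>f x\<bar> powr r > t} \<in> sets lebesgue" by measurable
  then have [measurable]: "{x. \<bar>f x\<bar> powr r > t} \<in> sets lebesgue" by simp
  have "ennreal t * emeasure lebesgue {x. \<bar>f x\<bar> powr r > t}
      = (\<integral>\<^sup>+x. ennreal t * indicator {x. \<bar>f x\<bar> powr r > t} x \<partial>lebesgue)"
    by (simp add: nn_integral_cmult_indicator)
  also have "\<dots> \<le> (\<integral>\<^sup>+x. ennreal (\<bar>f x\<bar> powr r) \<partial>lebesgue)"
    by (intro nn_integral_mono) (auto split: split_indicator intro!: ennreal_leI)
  finally show "ennreal t * emeasure lebesgue {x. \<bar>f x\<bar> powr r > t}
    \<le> (\<integral>\<^sup>+x. ennreal (\<bar>f x\<bar> powr r) \<partial>lebesgue)" .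
qed (use assms in auto)

lemma besov_order_mono:
  assumes "\<And>h. M (fwd_diff k h f) \<le> M' (fwd_diff k h f)"
  shows "besov_order M k s q f \<le> besov_order M' k s q f"
proof -
  have "modulus M k f t \<le> modulus M' k f t" for t
    unfolding modulus_def by (intro SUP_mono) (use assms in auto)
  then show ?thesis
    unfolding besov_order_def
    by (auto intro!: SUP_mono ennpowr_mono nn_integral_mono mult_right_mono divide_right_mono_ennreal)
qed

text \<open>The exponent \<lambda> appears as \<open>r\<close>. Since \<open>top\<close> times a
  positive number is \<open>top\<close>, one statement covers finite and infinite
  \<open>q\<close>.\<close>

theorem theorem1p12:
  fixes p s r :: real and q :: ennreal
  assumes "0 < p" and "0 < q" and "0 < s" and "0 < r" and "r < p"
  shows "\<exists>C::real. 0 < C \<and>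
    (\<forall>u :: real ^ 'n \<Rightarrow> real.
      u \<in> BMO \<inter> weak_besov_space s r (q * ennreal (r / p)) \<longrightarrow>
        besov_norm (s * (r / p)) p q u
          \<le> ennreal C * ennpowr (BMO_norm u) (1 - r / p)
              * ennpowr (weak_besov_norm s r (q * ennreal (r / p)) u) (r / p)
      \<and> ennreal C * ennpowr (BMO_norm u) (1 - r / p)
              * ennpowr (weak_besov_norm s r (q * ennreal (r / p)) u) (r / p)
          \<le> ennreal C * ennpowr (BMO_norm u) (1 - r / p)
              * ennpowr (besov_norm s r (q * ennreal (r / p)) u) (r / p))"
proof -
  let ?K = "diff_order s" and ?k = "diff_order (s * (r / p))"
  have rp: "0 < r / p" "r / p \<le> 1" using assms by auto
  have "s * (r / p) \<le> s" using rp assms by (intro mult_left_le) auto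
  then have kK: "?k \<le> ?K" by (rule diff_order_mono)
  have srp: "0 < s * (r / p)" using assms rp by simp
  \<comment> \<open>This puts \<open>u\<close> into the space of finite \<open>Lp_norm p\<close>,
    which the passage between the orders \<open>?k\<close> and \<open>?K\<close> requires.\<close>
  obtain C0 where C0: "0 < C0"
    "\<And>f :: real ^ 'n \<Rightarrow> real. f \<in> borel_measurable lebesgue \<Longrightarrow> BMO_norm f < top \<Longrightarrow> weak_Lp_norm r f < top \<Longrightarrow>
      Lp_norm p f \<le> ennreal C0 * ennpowr (BMO_norm f) (1 - r / p) * ennpowr (weak_Lp_norm r f) (r / p)"
    using Lp_norm_interpolation[OF assms(4,5)] by metis
  obtain C1 where C1: "0 < C1"
    "\<And>(u :: real ^ 'n \<Rightarrow> real) t. u \<in> borel_measurable lebesgue \<Longrightarrow> BMO_norm u < top \<Longrightarrow> weak_Lp_norm r u < top \<Longrightarrow>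
      modulus (Lp_norm p) ?K u t
        \<le> ennreal C1 * ennpowr (BMO_norm u) (1 - r / p) * ennpowr (modulus (weak_Lp_norm r) ?K u t) (r / p)"
    using modulus_interpolation[OF assms(4,5), where K = ?K] by metis
  obtain C2 where C2: "0 < C2"
    "\<And>f :: real ^ 'n \<Rightarrow> real. f \<in> borel_measurable lebesgue \<Longrightarrow> Lp_norm p f < top \<Longrightarrow>
      besov_order (Lp_norm p) ?k (s * (r / p)) q f \<le> ennreal C2 * besov_order (Lp_norm p) ?K (s * (r / p)) q f"
    using besov_order_le[OF assms(1,2) srp less_diff_order kK] by metis
  show ?thesis
  proof (intro exI[of _ "C2 * C1"] conjI allI impI)
    show "0 < C2 * C1" using C1 C2 by simp
  next
    fix u :: "real ^ 'n \<Rightarrow> real"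
    assume u: "u \<in> BMO \<inter> weak_besov_space s r (q * ennreal (r / p))"
    then have meas: "u \<in> borel_measurable lebesgue" and B: "BMO_norm u < top" and W: "weak_Lp_norm r u < top"
      by (auto simp: BMO_def weak_besov_space_def weak_Lp_space_def)
    have "Lp_norm p u < top"
      using C0(2)[OF meas B W] B W by (auto simp: ennreal_mult_less_top intro: order.strict_trans1)
    \<comment> \<open>The order \<open>?k\<close> belonging to the smaller smoothness is exchanged
      for \<open>?K\<close>, the order used by the weak seminorm of smoothness
      \<open>s\<close>.\<close>
    then have "besov_norm (s * (r / p)) p q u \<le> ennreal C2 * besov_order (Lp_norm p) ?K (s * (r / p)) q u"
      unfolding besov_norm_def besov_functional_eq by (intro C2 meas)
    also have "\<dots> \<le> ennreal C2 * (ennreal C1 * ennpowr (BMO_norm u) (1 - r / p)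
        * ennpowr (weak_besov_norm s r (q * ennreal (r / p)) u) (r / p))"
      unfolding weak_besov_norm_def besov_functional_eq
      by (intro mult_left_mono besov_order_interpolation C1(2)[OF meas B W] assms rp) auto
    finally show "besov_norm (s * (r / p)) p q u
          \<le> ennreal (C2 * C1) * ennpowr (BMO_norm u) (1 - r / p)
              * ennpowr (weak_besov_norm s r (q * ennreal (r / p)) u) (r / p)"
      using C1(1) C2(1) by (simp add: ennreal_mult mult.assoc)
    have "weak_besov_norm s r (q * ennreal (r / p)) u \<le> besov_norm s r (q * ennreal (r / p)) u"
      unfolding weak_besov_norm_def besov_norm_def besov_functional_eq
      using meas assms by (intro besov_order_mono weak_Lp_norm_le_Lp_norm) auto
    then show "ennreal (C2 * C1) * ennpowr (BMO_norm u) (1 - r / p)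
              * ennpowr (weak_besov_norm s r (q * ennreal (r / p)) u) (r / p)
          \<le> ennreal (C2 * C1) * ennpowr (BMO_norm u) (1 - r / p)
              * ennpowr (besov_norm s r (q * ennreal (r / p)) u) (r / p)"
      using rp by (intro mult_left_mono ennpowr_mono) auto
  qed
qed

end
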